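(* Let $\Gamma=(V,E)$ be a simplicial graph and $X$ a compact Hausdorff space. For each $v\in V$ let $G_v$ be a discrete group and $\alpha_v$ an action of $G_v$ on $X$ by homeomorphisms. Suppose that for each $v\in V$ the left transformation groupoid $G_v\rtimes X$ has the Haagerup property, and that the actions and the witnessing positive definite functions commute according to $\Gamma$; that is, $\{\alpha_v\}_{v\in V}$ commute according to $\Gamma$, and for each $v$ there is a sequence $\{\tilde h_{v,n}\}_{n}$ of unital positive definite functions witnessing the Haagerup property of $G_v\rtimes X$ such that for each $n$ the family $\{\tilde h_{v,n}\}_{v\in V}$ commutes according to $\Gamma$. Then $(\bigstar_\Gamma G_v)\rtimes X$ has the Haagerup property.
   Context: All groups (including $\bigstar_\Gamma G_v$) are countable and discrete. A simplicial graph is undirected, without loops, with at most one edge between two vertices. For a discrete group $G$ acting on $X$ by $\alpha$, the left transformation groupoid $G\rtimes X$ is $G\times X$ where $(s,x)$ has source $x$ and range $\alpha_s(x)$, and $(s,\alpha_t(x))(t,x)=(st,x)$. A continuous function $\tilde h:G\rtimes X\to\mathbb{C}$ is positive definite if for every $x\in X$ and all elements $\eta_1,\dots,\eta_n$ with range $x$ the matrix $[\tilde h(\eta_i^{-1}\eta_j)]_{i,j}$ is positive semidefinite; it is unital if $\tilde h(e,x)=1$ for all $x$. Such functions correspond, via $\tilde h(s,x)=h_s(x)$, to positive definite multipliers $h:G\to C(X)$ for the induced action $(\alpha_sf)(x)=f(\alpha_{s^{-1}}(x))$, i.e. maps with $[\alpha_{x_j}(h_{x_i^{-1}x_j})]_{i,j}\ge0$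 in $\mathbb{M}_n(C(X))$ for all $x_1,\dots,x_n\in G$. The groupoid $G\rtimes X$ has the Haagerup property if there is a sequence of positive definite functions in $C_0(G\times X)$ converging to $1$ uniformly on compact subsets of $G\times X$; such a sequence witnesses the property. The graph product $\bigstar_\Gamma G_v$ is the free product of the $G_v$ modulo $[g,h]=1$ for $g\in G_v$, $h\in G_w$, $(v,w)\in E$. The actions commute according to $\Gamma$ if $\alpha_{v,g}\alpha_{w,h}=\alpha_{w,h}\alpha_{v,g}$ whenever $(v,w)\in E$, $g\in G_v$, $h\in G_w$; then $\bigstar_\Gamma G_v$ acts on $X$ by the unique action extending all $\alpha_v$, and $(\bigstar_\Gamma G_v)\rtimes X$ is the corresponding groupoid. Unital positive definite functions $\tilde h_v$ on $G_v\rtimes X$ commute according to $\Gamma$ if the corresponding multipliers $h_v:G_v\to C(X)$ satisfy, whenever $(v,w)\in E$, $\alpha_{v,a}(h_{w,b})=h_{w,b}$ and $\alpha_{w,b}(h_{v,a})=h_{v,a}$ for all $a\in G_v$, $b\in G_w$. *)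

theory Defs
  imports "HOL-Analysis.Analysis" "HOL-Algebra.Group_Action"
begin

section \<open>Graph products of groups\<close>

text \<open>An edge \<open>{v, w}\<close> is represented by the two pairs \<open>(v, w)\<close> and \<open>(w, v)\<close>.\<close>

definition simplicial_graph :: "'v set \<Rightarrow> 'v rel \<Rightarrow> bool" where
  "simplicial_graph V E \<longleftrightarrow> E \<subseteq> V \<times> V \<and> sym E \<and> irrefl E"

text \<open>The free product consists of all words in the disjoint union of the groups, modulo the
  smallest equivalence relation that allows deleting (inserting) a neutral letter and multiplying
  (splitting) letters from the same group, at any position of a word.\<close>

definition fp_words :: "'v set \<Rightarrow> ('v \<Rightarrow> ('g, 'm) monoid_scheme) \<Rightarrow> ('v \<times> 'g) list set" where
  "fp_words V G = lists (SIGMA v:V. carrier (G v))"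

inductive_set fp_rel :: "'v set \<Rightarrow> ('v \<Rightarrow> ('g, 'm) monoid_scheme) \<Rightarrow> ('v \<times> 'g) list rel"
  for V G where
  refl: "xs \<in> fp_words V G \<Longrightarrow> (xs, xs) \<in> fp_rel V G"
| sym: "(xs, ys) \<in> fp_rel V G \<Longrightarrow> (ys, xs) \<in> fp_rel V G"
| trans: "(xs, ys) \<in> fp_rel V G \<Longrightarrow> (ys, zs) \<in> fp_rel V G \<Longrightarrow> (xs, zs) \<in> fp_rel V G"
| one: "v \<in> V \<Longrightarrow> xs \<in> fp_words V G \<Longrightarrow> ys \<in> fp_words V G \<Longrightarrow>
    (xs @ (v, \<one>\<^bsub>G v\<^esub>) # ys, xs @ ys) \<in> fp_rel V G"
| mult: "v \<in> V \<Longrightarrow> g \<in> carrier (G v) \<Longrightarrow> h \<in> carrier (G v) \<Longrightarrow>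
    xs \<in> fp_words V G \<Longrightarrow> ys \<in> fp_words V G \<Longrightarrow>
    (xs @ (v, g) # (v, h) # ys, xs @ (v, g \<otimes>\<^bsub>G v\<^esub> h) # ys) \<in> fp_rel V G"

definition free_product ::
    "'v set \<Rightarrow> ('v \<Rightarrow> ('g, 'm) monoid_scheme) \<Rightarrow> ('v \<times> 'g) list set monoid" where
  "free_product V G =
     \<lparr>carrier = fp_words V G // fp_rel V G,
      mult = (\<lambda>A B. \<Union>xs\<in>A. \<Union>ys\<in>B. fp_rel V G `` {xs @ ys}),
      one = fp_rel V G `` {[]}\<rparr>"

definition fp_incl ::
    "'v set \<Rightarrow> ('v \<Rightarrow> ('g, 'm) monoid_scheme) \<Rightarrow> 'v \<Rightarrow> 'g \<Rightarrow> ('v \<times> 'g) list set" where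
  "fp_incl V G v g = fp_rel V G `` {[(v, g)]}"

definition normal_closure :: "('a, 'b) monoid_scheme \<Rightarrow> 'a set \<Rightarrow> 'a set" where
  "normal_closure G S = \<Inter>{N. N \<lhd> G \<and> S \<subseteq> N}"

definition gp_relators ::
    "'v set \<Rightarrow> 'v rel \<Rightarrow> ('v \<Rightarrow> ('g, 'm) monoid_scheme) \<Rightarrow> ('v \<times> 'g) list set set" where
  "gp_relators V E G =
     {a \<otimes>\<^bsub>free_product V G\<^esub> b \<otimes>\<^bsub>free_product V G\<^esub> inv\<^bsub>free_product V G\<^esub> a
        \<otimes>\<^bsub>free_product V G\<^esub> inv\<^bsub>free_product V G\<^esub> b
      | a b v w g h. (v, w) \<in> E \<and> g \<in> carrier (G v) \<and> h \<in> carrier (G w)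
          \<and> a = fp_incl V G v g \<and> b = fp_incl V G w h}"

definition graph_product ::
    "'v set \<Rightarrow> 'v rel \<Rightarrow> ('v \<Rightarrow> ('g, 'm) monoid_scheme) \<Rightarrow> ('v \<times> 'g) list set set monoid" where
  "graph_product V E G =
     free_product V G Mod normal_closure (free_product V G) (gp_relators V E G)"

definition gp_incl ::
    "'v set \<Rightarrow> 'v rel \<Rightarrow> ('v \<Rightarrow> ('g, 'm) monoid_scheme) \<Rightarrow> 'v \<Rightarrow> 'g
       \<Rightarrow> ('v \<times> 'g) list set set" where
  "gp_incl V E G v g =
     normal_closure (free_product V G) (gp_relators V E G) #>\<^bsub>free_product V G\<^esub> fp_incl V G v g"


section \<open>Actions on spaces and their transformation groupoids\<close>

definition homeo_action ::
    "('g, 'm) monoid_scheme \<Rightarrow> 'x topology \<Rightarrow> ('g \<Rightarrow> 'x \<Rightarrow> 'x) \<Rightarrow> bool" where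
  "homeo_action G X \<alpha> \<longleftrightarrow>
     group_action G (topspace X) \<alpha> \<and> (\<forall>g\<in>carrier G. homeomorphic_map X X (\<alpha> g))"

definition commuting_actions ::
    "'v rel \<Rightarrow> ('v \<Rightarrow> ('g, 'm) monoid_scheme) \<Rightarrow> 'x topology \<Rightarrow> ('v \<Rightarrow> 'g \<Rightarrow> 'x \<Rightarrow> 'x) \<Rightarrow> bool" where
  "commuting_actions E G X \<alpha> \<longleftrightarrow>
     (\<forall>(v, w)\<in>E. \<forall>g\<in>carrier (G v). \<forall>h\<in>carrier (G w). \<forall>x\<in>topspace X.
        \<alpha> v g (\<alpha> w h x) = \<alpha> w h (\<alpha> v g x))"

text \<open>Extensionality only fixes the irrelevant values outside the carrier, as required for the
  definite description; existence and uniqueness are \<open>graph_product_action_unique\<close> below.\<close>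

definition graph_product_action ::
    "'v set \<Rightarrow> 'v rel \<Rightarrow> ('v \<Rightarrow> ('g, 'm) monoid_scheme) \<Rightarrow> 'x topology \<Rightarrow> ('v \<Rightarrow> 'g \<Rightarrow> 'x \<Rightarrow> 'x)
       \<Rightarrow> ('v \<times> 'g) list set set \<Rightarrow> 'x \<Rightarrow> 'x" where
  "graph_product_action V E G X \<alpha> =
     (THE \<beta>. \<beta> \<in> extensional (carrier (graph_product V E G))
        \<and> homeo_action (graph_product V E G) X \<beta>
        \<and> (\<forall>v\<in>V. \<forall>g\<in>carrier (G v). \<beta> (gp_incl V E G v g) = \<alpha> v g))"

text \<open>The groupoid has underlying set \<open>carrier G \<times> topspace X\<close>. The product below is meant for
  composable pairs, \<open>(s, y)(t, x)\<close> with \<open>y = \<alpha> t x\<close>.\<close>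

definition tg_topology :: "('g, 'm) monoid_scheme \<Rightarrow> 'x topology \<Rightarrow> ('g \<times> 'x) topology" where
  "tg_topology G X = prod_topology (discrete_topology (carrier G)) X"

fun tg_range :: "('g \<Rightarrow> 'x \<Rightarrow> 'x) \<Rightarrow> 'g \<times> 'x \<Rightarrow> 'x" where
  "tg_range \<alpha> (s, x) = \<alpha> s x"

fun tg_mult :: "('g, 'm) monoid_scheme \<Rightarrow> 'g \<times> 'x \<Rightarrow> 'g \<times> 'x \<Rightarrow> 'g \<times> 'x" where
  "tg_mult G (s, y) (t, x) = (s \<otimes>\<^bsub>G\<^esub> t, x)"

fun tg_inv :: "('g, 'm) monoid_scheme \<Rightarrow> ('g \<Rightarrow> 'x \<Rightarrow> 'x) \<Rightarrow> 'g \<times> 'x \<Rightarrow> 'g \<times> 'x" where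
  "tg_inv G \<alpha> (s, x) = (inv\<^bsub>G\<^esub> s, \<alpha> s x)"

text \<open>The \<open>n \<times> n\<close> matrix consists of the entries with indices below \<open>n\<close>; over the complex numbers,
  real quadratic forms force the matrix to be Hermitian.\<close>

definition psd_matrix :: "nat \<Rightarrow> (nat \<Rightarrow> nat \<Rightarrow> complex) \<Rightarrow> bool" where
  "psd_matrix n A \<longleftrightarrow>
     (\<forall>c :: nat \<Rightarrow> complex. (\<Sum>i<n. \<Sum>j<n. cnj (c i) * A i j * c j) \<in> \<real>\<^sub>\<ge>\<^sub>0)"

definition tg_positive_definite ::
    "('g, 'm) monoid_scheme \<Rightarrow> 'x topology \<Rightarrow> ('g \<Rightarrow> 'x \<Rightarrow> 'x) \<Rightarrow> ('g \<times> 'x \<Rightarrow> complex) \<Rightarrow> bool" where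
  "tg_positive_definite G X \<alpha> h \<longleftrightarrow>
     continuous_map (tg_topology G X) euclidean h \<and>
     (\<forall>x\<in>topspace X. \<forall>n. \<forall>\<eta> :: nat \<Rightarrow> 'g \<times> 'x.
        (\<forall>i<n. \<eta> i \<in> carrier G \<times> topspace X \<and> tg_range \<alpha> (\<eta> i) = x) \<longrightarrow>
        psd_matrix n (\<lambda>i j. h (tg_mult G (tg_inv G \<alpha> (\<eta> i)) (\<eta> j))))"

definition tg_unital ::
    "('g, 'm) monoid_scheme \<Rightarrow> 'x topology \<Rightarrow> ('g \<times> 'x \<Rightarrow> complex) \<Rightarrow> bool" where
  "tg_unital G X h \<longleftrightarrow> (\<forall>x\<in>topspace X. h (\<one>\<^bsub>G\<^esub>, x) = 1)"

definition C0_functions :: "'a topology \<Rightarrow> ('a \<Rightarrow> complex) set" where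
  "C0_functions Y = {f. continuous_map Y euclidean f \<and>
     (\<forall>\<epsilon>>0. \<exists>K. compactin Y K \<and> (\<forall>p\<in>topspace Y - K. cmod (f p) < \<epsilon>))}"

definition haagerup_witness ::
    "('g, 'm) monoid_scheme \<Rightarrow> 'x topology \<Rightarrow> ('g \<Rightarrow> 'x \<Rightarrow> 'x) \<Rightarrow> (nat \<Rightarrow> 'g \<times> 'x \<Rightarrow> complex) \<Rightarrow> bool"
  where
  "haagerup_witness G X \<alpha> h \<longleftrightarrow>
     (\<forall>n. tg_positive_definite G X \<alpha> (h n) \<and> h n \<in> C0_functions (tg_topology G X)) \<and>
     (\<forall>K. compactin (tg_topology G X) K \<longrightarrow> uniform_limit K h (\<lambda>_. 1) sequentially)"

definition tg_haagerup ::
    "('g, 'm) monoid_scheme \<Rightarrow> 'x topology \<Rightarrow> ('g \<Rightarrow> 'x \<Rightarrow> 'x) \<Rightarrow> bool" where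
  "tg_haagerup G X \<alpha> \<longleftrightarrow> (\<exists>h. haagerup_witness G X \<alpha> h)"

definition multiplier :: "('g \<times> 'x \<Rightarrow> complex) \<Rightarrow> 'g \<Rightarrow> 'x \<Rightarrow> complex" where
  "multiplier h s = (\<lambda>x. h (s, x))"

definition induced_action ::
    "('g, 'm) monoid_scheme \<Rightarrow> ('g \<Rightarrow> 'x \<Rightarrow> 'x) \<Rightarrow> 'g \<Rightarrow> ('x \<Rightarrow> complex) \<Rightarrow> 'x \<Rightarrow> complex" where
  "induced_action G \<alpha> s f = (\<lambda>x. f (\<alpha> (inv\<^bsub>G\<^esub> s) x))"

definition commuting_multipliers ::
    "'v rel \<Rightarrow> ('v \<Rightarrow> ('g, 'm) monoid_scheme) \<Rightarrow> 'x topology \<Rightarrow> ('v \<Rightarrow> 'g \<Rightarrow> 'x \<Rightarrow> 'x)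
       \<Rightarrow> ('v \<Rightarrow> 'g \<times> 'x \<Rightarrow> complex) \<Rightarrow> bool" where
  "commuting_multipliers E G X \<alpha> h \<longleftrightarrow>
     (\<forall>(v, w)\<in>E. \<forall>a\<in>carrier (G v). \<forall>b\<in>carrier (G w). \<forall>x\<in>topspace X.
        induced_action (G v) (\<alpha> v) a (multiplier (h w) b) x = multiplier (h w) b x \<and>
        induced_action (G w) (\<alpha> w) b (multiplier (h v) a) x = multiplier (h v) a x)"


section \<open>Universal properties\<close>

lemma fp_words_simps [simp]:
  "[] \<in> fp_words V G"
  "(v, g) # xs \<in> fp_words V G \<longleftrightarrow> v \<in> V \<and> g \<in> carrier (G v) \<and> xs \<in> fp_words V G"
  "xs @ ys \<in> fp_words V G \<longleftrightarrow> xs \<in> fp_words V G \<and> ys \<in> fp_words V G"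
  by (auto simp: fp_words_def)

locale group_family =
  fixes V :: "'v set" and G :: "'v \<Rightarrow> ('g, 'm) monoid_scheme"
  assumes grp: "\<And>v. v \<in> V \<Longrightarrow> group (G v)"
begin

abbreviation "F \<equiv> free_product V G"
abbreviation "cls xs \<equiv> fp_rel V G `` {xs}"

lemma fp_rel_words: "(xs, ys) \<in> fp_rel V G \<Longrightarrow> xs \<in> fp_words V G \<and> ys \<in> fp_words V G"
proof (induction rule: fp_rel.induct)
  case (one v xs ys)
  then interpret Gv: group "G v" by (rule_tac grp)
  show ?case using one by simp
next
  case (mult v g h xs ys)
  then interpret Gv: group "G v" by (rule_tac grp)
  show ?case using mult by simp
qed auto

lemma equiv_fp_rel: "equiv (fp_words V G) (fp_rel V G)"
proof (rule equivI)
  show "fp_rel V G \<subseteq> fp_words V G \<times> fp_words V G" using fp_rel_words by auto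
  show "refl_on (fp_words V G) (fp_rel V G)"
    by (auto simp: refl_on_def intro: fp_rel.refl)
  show "Relation.sym (fp_rel V G)" unfolding sym_def by (blast intro: fp_rel.sym)
  show "Relation.trans (fp_rel V G)" unfolding trans_def by (blast intro: fp_rel.trans)
qed

lemma fp_rel_context:
  assumes "(xs, ys) \<in> fp_rel V G" "as \<in> fp_words V G" "bs \<in> fp_words V G"
  shows "(as @ xs @ bs, as @ ys @ bs) \<in> fp_rel V G"
  using assms(1)
proof (induction rule: fp_rel.induct)
  case (refl xs)
  then show ?case using assms by (auto intro: fp_rel.refl)
next
  case (sym xs ys)
  then show ?case by (rule_tac fp_rel.sym)
next
  case (trans xs ys zs)
  then show ?case by (rule_tac fp_rel.trans)
next
  case (one v xs ys)
  then show ?case using fp_rel.one[of v V "as @ xs" G "ys @ bs"] assms by simp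
next
  case (mult v g h xs ys)
  then show ?case using fp_rel.mult[of v V g G h "as @ xs" "ys @ bs"] assms by simp
qed

lemma fp_rel_append:
  assumes "(xs, xs') \<in> fp_rel V G" "(ys, ys') \<in> fp_rel V G"
  shows "(xs @ ys, xs' @ ys') \<in> fp_rel V G"
proof (rule fp_rel.trans)
  show "(xs @ ys, xs' @ ys) \<in> fp_rel V G"
    using fp_rel_context[OF assms(1), of "[]" ys] fp_rel_words[OF assms(2)] by simp
  show "(xs' @ ys, xs' @ ys') \<in> fp_rel V G"
    using fp_rel_context[OF assms(2), of xs' "[]"] fp_rel_words[OF assms(1)] by simp
qed

lemma cls_eq_iff:
  "xs \<in> fp_words V G \<Longrightarrow> ys \<in> fp_words V G \<Longrightarrow> cls xs = cls ys \<longleftrightarrow> (xs, ys) \<in> fp_rel V G"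
  using eq_equiv_class_iff[OF equiv_fp_rel] by blast

lemma carrier_fp: "carrier F = cls ` fp_words V G"
  by (auto simp: free_product_def quotient_def)

lemma one_fp: "\<one>\<^bsub>F\<^esub> = cls []"
  by (simp add: free_product_def)

lemma mult_fp:
  assumes "xs \<in> fp_words V G" "ys \<in> fp_words V G"
  shows "cls xs \<otimes>\<^bsub>F\<^esub> cls ys = cls (xs @ ys)"
proof -
  have "cls (xs' @ ys') = cls (xs @ ys)" if "xs' \<in> cls xs" "ys' \<in> cls ys" for xs' ys'
  proof -
    have "(xs @ ys, xs' @ ys') \<in> fp_rel V G" using that by (intro fp_rel_append) simp_all
    from equiv_class_eq[OF equiv_fp_rel this] show ?thesis by simp
  qed
  then have "(\<Union>xs'\<in>cls xs. \<Union>ys'\<in>cls ys. cls (xs' @ ys'))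
               = (\<Union>xs'\<in>cls xs. \<Union>ys'\<in>cls ys. cls (xs @ ys))"
    by simp
  moreover have "cls xs \<noteq> {}" "cls ys \<noteq> {}" using assms fp_rel.refl by blast+
  ultimately show ?thesis by (simp add: free_product_def)
qed

lemma fp_word_left_inverse:
  "xs \<in> fp_words V G \<Longrightarrow> \<exists>ys\<in>fp_words V G. (ys @ xs, []) \<in> fp_rel V G"
proof (induction xs)
  case Nil
  then show ?case by (auto intro!: bexI[of _ "[]"] fp_rel.refl)
next
  case (Cons a xs)
  obtain v g where a: "a = (v, g)" by (cases a)
  with Cons.prems have v: "v \<in> V" "g \<in> carrier (G v)" "xs \<in> fp_words V G" by auto
  interpret Gv: group "G v" using grp v by blast
  obtain ys where ys: "ys \<in> fp_words V G" "(ys @ xs, []) \<in> fp_rel V G"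
    using Cons.IH v by blast
  have "(ys @ (v, inv\<^bsub>G v\<^esub> g) # (v, g) # xs, ys @ (v, \<one>\<^bsub>G v\<^esub>) # xs) \<in> fp_rel V G"
    using fp_rel.mult[of v V "inv\<^bsub>G v\<^esub> g" G g ys xs] v ys by simp
  moreover have "(ys @ (v, \<one>\<^bsub>G v\<^esub>) # xs, ys @ xs) \<in> fp_rel V G"
    using fp_rel.one[of v V ys G xs] v ys by simp
  ultimately have "(ys @ (v, inv\<^bsub>G v\<^esub> g) # (v, g) # xs, []) \<in> fp_rel V G"
    using ys(2) fp_rel.trans by blast
  then have "((ys @ [(v, inv\<^bsub>G v\<^esub> g)]) @ a # xs, []) \<in> fp_rel V G"
    by (simp add: a)
  then show ?case using ys v by (intro bexI[of _ "ys @ [(v, inv\<^bsub>G v\<^esub> g)]"]) auto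
qed

lemma group_fp: "group F"
proof (rule groupI)
  fix x assume "x \<in> carrier F"
  then obtain xs where xs: "xs \<in> fp_words V G" "x = cls xs" by (auto simp: carrier_fp)
  then obtain ys where ys: "ys \<in> fp_words V G" "(ys @ xs, []) \<in> fp_rel V G"
    using fp_word_left_inverse by blast
  then have "cls ys \<otimes>\<^bsub>F\<^esub> x = \<one>\<^bsub>F\<^esub>"
    using xs by (simp add: mult_fp one_fp cls_eq_iff)
  then show "\<exists>y\<in>carrier F. y \<otimes>\<^bsub>F\<^esub> x = \<one>\<^bsub>F\<^esub>" using ys by (auto simp: carrier_fp)
qed (auto simp: carrier_fp one_fp mult_fp)

lemma fp_incl_hom: "v \<in> V \<Longrightarrow> fp_incl V G v \<in> hom (G v) F"
proof (rule homI)
  fix g h assume v: "v \<in> V" "g \<in> carrier (G v)" "h \<in> carrier (G v)"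
  interpret Gv: group "G v" using grp v by blast
  have "([(v, g), (v, h)], [(v, g \<otimes>\<^bsub>G v\<^esub> h)]) \<in> fp_rel V G"
    using fp_rel.mult[of v V g G h "[]" "[]"] v by simp
  then show "fp_incl V G v (g \<otimes>\<^bsub>G v\<^esub> h) = fp_incl V G v g \<otimes>\<^bsub>F\<^esub> fp_incl V G v h"
    using v by (simp add: fp_incl_def mult_fp cls_eq_iff fp_rel.sym)
qed (auto simp: fp_incl_def carrier_fp)

lemma fp_universal:
  assumes "group H" and \<phi>: "\<And>v. v \<in> V \<Longrightarrow> \<phi> v \<in> hom (G v) H"
  obtains f where "f \<in> hom F H" "\<And>v g. v \<in> V \<Longrightarrow> g \<in> carrier (G v) \<Longrightarrow> f (fp_incl V G v g) = \<phi> v g"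
proof -
  interpret H: group H by fact
  define e where "e = (\<lambda>xs. foldr (\<lambda>(v, g) y. \<phi> v g \<otimes>\<^bsub>H\<^esub> y) xs \<one>\<^bsub>H\<^esub>)"
  have e_simps: "e [] = \<one>\<^bsub>H\<^esub>" "\<And>v g xs. e ((v, g) # xs) = \<phi> v g \<otimes>\<^bsub>H\<^esub> e xs"
    by (auto simp: e_def)
  have \<phi>_closed: "\<phi> v g \<in> carrier H" if "v \<in> V" "g \<in> carrier (G v)" for v g
    using \<phi>[OF that(1)] that by (auto simp: hom_def)
  have e_closed: "e xs \<in> carrier H" if "xs \<in> fp_words V G" for xs
    using that by (induction xs) (auto simp: e_simps \<phi>_closed)
  have e_append: "e (xs @ ys) = e xs \<otimes>\<^bsub>H\<^esub> e ys"
    if "xs \<in> fp_words V G" "ys \<in> fp_words V G" for xs ys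
    using that by (induction xs) (auto simp: e_simps \<phi>_closed e_closed H.m_assoc)
  have e_rel: "e xs = e ys" if "(xs, ys) \<in> fp_rel V G" for xs ys
    using that
  proof (induction rule: fp_rel.induct)
    case (trans xs ys zs)
    then show ?case by simp
  next
    case (one v xs ys)
    interpret Gv: group "G v" by (rule grp) (rule one)
    have "\<phi> v \<one>\<^bsub>G v\<^esub> = \<one>\<^bsub>H\<^esub>" by (rule hom_one[OF \<phi> grp assms(1)]) (rule one)+
    then show ?case using one by (simp add: e_append e_simps e_closed)
  next
    case (mult v g h xs ys)
    interpret Gv: group "G v" by (rule grp) (rule mult)
    have "\<phi> v (g \<otimes>\<^bsub>G v\<^esub> h) = \<phi> v g \<otimes>\<^bsub>H\<^esub> \<phi> v h" by (rule hom_mult[OF \<phi>]) (rule mult)+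
    then show ?case using mult by (simp add: e_append e_simps e_closed \<phi>_closed H.m_assoc)
  qed auto
  define f where "f = (\<lambda>A. e (SOME xs. xs \<in> A))"
  have f_cls: "f (cls xs) = e xs" if "xs \<in> fp_words V G" for xs
  proof -
    have "xs \<in> cls xs" using that by (simp add: fp_rel.refl)
    then have "(SOME ys. ys \<in> cls xs) \<in> cls xs" by (rule someI)
    then show ?thesis using e_rel[of xs "SOME ys. ys \<in> cls xs"] by (simp add: f_def)
  qed
  show thesis
  proof
    show "f \<in> hom F H"
      by (rule homI) (auto simp: carrier_fp f_cls e_closed mult_fp e_append)
    show "f (fp_incl V G v g) = \<phi> v g" if "v \<in> V" "g \<in> carrier (G v)" for v g
      using that by (simp add: fp_incl_def f_cls e_simps \<phi>_closed)
  qed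
qed

lemma fp_induct [consumes 1, case_names one step]:
  assumes "x \<in> carrier F" "P \<one>\<^bsub>F\<^esub>"
    and step: "\<And>v g y. v \<in> V \<Longrightarrow> g \<in> carrier (G v) \<Longrightarrow> y \<in> carrier F \<Longrightarrow> P y
           \<Longrightarrow> P (fp_incl V G v g \<otimes>\<^bsub>F\<^esub> y)"
  shows "P x"
proof -
  have "P (cls xs)" if "xs \<in> fp_words V G" for xs
    using that
  proof (induction xs)
    case Nil
    then show ?case using assms by (simp add: one_fp)
  next
    case (Cons a xs)
    then obtain v g where a: "a = (v, g)" "v \<in> V" "g \<in> carrier (G v)" "xs \<in> fp_words V G"
      by (cases a) auto
    then have "cls (a # xs) = fp_incl V G v g \<otimes>\<^bsub>F\<^esub> cls xs"
      by (simp add: fp_incl_def mult_fp)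
    then show ?case using step[of v g "cls xs"] Cons.IH a by (auto simp: carrier_fp)
  qed
  then show ?thesis using assms(1) by (auto simp: carrier_fp)
qed

end

lemma (in group) normal_closure_normal:
  assumes "S \<subseteq> carrier G"
  shows "normal_closure G S \<lhd> G"
proof -
  have "carrier G \<lhd> G" by (simp add: normal_inv_iff subgroup_self)
  then have ne: "{N. N \<lhd> G \<and> S \<subseteq> N} \<noteq> {}" using assms by blast
  have "subgroup (normal_closure G S) G"
    unfolding normal_closure_def
    by (rule subgroups_Inter[OF _ ne]) (auto intro: normal_imp_subgroup)
  then show ?thesis by (auto simp: normal_inv_iff normal_closure_def)
qed

locale group_graph = group_family +
  fixes E :: "'a rel"
  assumes graph: "simplicial_graph V E"
begin

abbreviation "N \<equiv> normal_closure F (gp_relators V E G)"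
abbreviation "P \<equiv> graph_product V E G"

lemma fp_incl_closed: "v \<in> V \<Longrightarrow> g \<in> carrier (G v) \<Longrightarrow> fp_incl V G v g \<in> carrier F"
  using fp_incl_hom by (auto simp: hom_def)

lemma edge_in: "(v, w) \<in> E \<Longrightarrow> v \<in> V \<and> w \<in> V"
  using graph by (auto simp: simplicial_graph_def)

lemma gp_relators_subset: "gp_relators V E G \<subseteq> carrier F"
proof -
  interpret F: group F by (rule group_fp)
  show ?thesis by (auto simp: gp_relators_def dest!: edge_in intro: fp_incl_closed)
qed

lemma normal_N: "N \<lhd> F"
  using group.normal_closure_normal[OF group_fp gp_relators_subset] .

lemma group_gp: "group P"
  unfolding graph_product_def by (rule normal.factorgroup_is_group[OF normal_N])

lemma coset_hom: "(\<lambda>x. N #>\<^bsub>F\<^esub> x) \<in> hom F P"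
  unfolding graph_product_def by (rule normal.r_coset_hom_Mod[OF normal_N])

lemma carrier_gp: "carrier P = (\<lambda>x. N #>\<^bsub>F\<^esub> x) ` carrier F"
  by (simp add: graph_product_def carrier_FactGroup)

lemma gp_incl_hom: "v \<in> V \<Longrightarrow> gp_incl V E G v \<in> hom (G v) P"
  using hom_compose[OF fp_incl_hom coset_hom] by (simp add: gp_incl_def[abs_def] comp_def)

lemma gp_induct [consumes 1, case_names one step]:
  assumes "x \<in> carrier P" "Q \<one>\<^bsub>P\<^esub>"
    and step: "\<And>v g y. v \<in> V \<Longrightarrow> g \<in> carrier (G v) \<Longrightarrow> y \<in> carrier P \<Longrightarrow> Q y
           \<Longrightarrow> Q (gp_incl V E G v g \<otimes>\<^bsub>P\<^esub> y)"
  shows "Q x"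
proof -
  interpret F: group F by (rule group_fp)
  have "Q (N #>\<^bsub>F\<^esub> y)" if "y \<in> carrier F" for y
    using that
  proof (induction rule: fp_induct)
    case one
    then show ?case using assms(2) hom_one[OF coset_hom group_fp group_gp] by simp
  next
    case (step v g y)
    have "N #>\<^bsub>F\<^esub> (fp_incl V G v g \<otimes>\<^bsub>F\<^esub> y) = gp_incl V E G v g \<otimes>\<^bsub>P\<^esub> (N #>\<^bsub>F\<^esub> y)"
      using hom_mult[OF coset_hom] step fp_incl_closed by (simp add: gp_incl_def)
    then show ?case using assms(3)[of v g "N #>\<^bsub>F\<^esub> y"] step by (auto simp: carrier_gp)
  qed
  then show ?thesis using assms(1) by (auto simp: carrier_gp)
qed

lemma gp_universal:
  assumes "group H" and \<phi>: "\<And>v. v \<in> V \<Longrightarrow> \<phi> v \<in> hom (G v) H"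
    and comm: "\<And>v w g h. (v, w) \<in> E \<Longrightarrow> g \<in> carrier (G v) \<Longrightarrow> h \<in> carrier (G w)
           \<Longrightarrow> \<phi> v g \<otimes>\<^bsub>H\<^esub> \<phi> w h = \<phi> w h \<otimes>\<^bsub>H\<^esub> \<phi> v g"
  obtains f where "f \<in> hom P H"
    "\<And>v g. v \<in> V \<Longrightarrow> g \<in> carrier (G v) \<Longrightarrow> f (gp_incl V E G v g) = \<phi> v g"
proof -
  interpret F: group F by (rule group_fp)
  interpret H: group H by fact
  obtain f where f: "f \<in> hom F H"
    "\<And>v g. v \<in> V \<Longrightarrow> g \<in> carrier (G v) \<Longrightarrow> f (fp_incl V G v g) = \<phi> v g"
    using fp_universal[of H \<phi>] assms by blast
  interpret f: group_hom F H f by unfold_locales (rule f)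
  have "gp_relators V E G \<subseteq> kernel F H f"
  proof
    fix r assume "r \<in> gp_relators V E G"
    then obtain v w g h where vw: "(v, w) \<in> E" "g \<in> carrier (G v)" "h \<in> carrier (G w)"
      and r: "r = fp_incl V G v g \<otimes>\<^bsub>F\<^esub> fp_incl V G w h \<otimes>\<^bsub>F\<^esub> inv\<^bsub>F\<^esub> fp_incl V G v g
                \<otimes>\<^bsub>F\<^esub> inv\<^bsub>F\<^esub> fp_incl V G w h"
      by (auto simp: gp_relators_def)
    note V = edge_in[OF vw(1)]
    have a: "fp_incl V G v g \<in> carrier F" "fp_incl V G w h \<in> carrier F"
      using V vw by (auto intro: fp_incl_closed)
    have c: "\<phi> v g \<in> carrier H" "\<phi> w h \<in> carrier H"
      using \<phi> V vw by (auto simp: hom_def)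
    have "f r = \<phi> v g \<otimes>\<^bsub>H\<^esub> \<phi> w h \<otimes>\<^bsub>H\<^esub> inv\<^bsub>H\<^esub> \<phi> v g \<otimes>\<^bsub>H\<^esub> inv\<^bsub>H\<^esub> \<phi> w h"
      using a f(2) V vw by (simp add: r)
    also have "\<dots> = \<one>\<^bsub>H\<^esub>"
      using c by (simp add: comm[OF vw] H.m_assoc)
    finally show "r \<in> kernel F H f" using a by (simp add: kernel_def r)
  qed
  then have "N \<subseteq> kernel F H f"
    using f.normal_kernel by (auto simp: normal_closure_def)
  then obtain k where k: "k \<in> hom (F Mod N) H" "\<And>x. x \<in> carrier F \<Longrightarrow> k (N #>\<^bsub>F\<^esub> x) = f x"
    using f.FactGroup_universal_kernel[OF normal_N] by blast
  show thesis
    by (rule that[of k]) (use k f fp_incl_closed in \<open>auto simp: graph_product_def gp_incl_def\<close>)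
qed

lemma graph_product_action_unique:
  assumes act: "\<And>v. v \<in> V \<Longrightarrow> homeo_action (G v) X (\<alpha> v)"
    and comm: "commuting_actions E G X \<alpha>"
  shows "\<exists>!\<beta>. \<beta> \<in> extensional (carrier P) \<and> homeo_action P X \<beta>
           \<and> (\<forall>v\<in>V. \<forall>g\<in>carrier (G v). \<beta> (gp_incl V E G v g) = \<alpha> v g)"
proof -
  interpret P: group P by (rule group_gp)
  let ?B = "BijGroup (topspace X)"
  interpret B: group ?B by (rule group_BijGroup)
  have hom: "\<alpha> v \<in> hom (G v) ?B" if "v \<in> V" for v
    using act[OF that] by (auto simp: homeo_action_def group_action_def group_hom_def group_hom_axioms_def)
  have Bij: "\<alpha> v g \<in> Bij (topspace X)" if "v \<in> V" "g \<in> carrier (G v)" for v g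
    using hom[OF that(1)] that by (auto simp: hom_def BijGroup_def)
  have B_comm: "\<alpha> v g \<otimes>\<^bsub>?B\<^esub> \<alpha> w h = \<alpha> w h \<otimes>\<^bsub>?B\<^esub> \<alpha> v g"
    if "(v, w) \<in> E" "g \<in> carrier (G v)" "h \<in> carrier (G w)" for v w g h
  proof -
    have "\<forall>x\<in>topspace X. \<alpha> v g (\<alpha> w h x) = \<alpha> w h (\<alpha> v g x)"
      using comm that unfolding commuting_actions_def by blast
    then show ?thesis
      using Bij edge_in[OF that(1)] that(2,3)
      by (simp add: BijGroup_def compose_def cong: restrict_cong)
  qed
  obtain f where f: "f \<in> hom P ?B"
    "\<And>v g. v \<in> V \<Longrightarrow> g \<in> carrier (G v) \<Longrightarrow> f (gp_incl V E G v g) = \<alpha> v g"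
  proof (rule gp_universal[of ?B \<alpha>])
    fix f assume "f \<in> hom P ?B"
      "\<And>v g. v \<in> V \<Longrightarrow> g \<in> carrier (G v) \<Longrightarrow> f (gp_incl V E G v g) = \<alpha> v g"
    then show thesis by (rule that)
  qed (rule group_BijGroup, erule hom, rule B_comm, assumption+)
  have incl: "gp_incl V E G v g \<in> carrier P" if "v \<in> V" "g \<in> carrier (G v)" for v g
    using gp_incl_hom[OF that(1)] that by (auto simp: hom_def)
  have homeo: "homeomorphic_map X X (f x)" if "x \<in> carrier P" for x
    using that
  proof (induction rule: gp_induct)
    case one
    have "f \<one>\<^bsub>P\<^esub> = (\<lambda>x\<in>topspace X. x)"
      using hom_one[OF f(1) group_gp group_BijGroup] by (simp add: BijGroup_def)
    moreover have "homeomorphic_map X X (\<lambda>x\<in>topspace X. x)"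
      by (rule homeomorphic_map_eq[of X X id]) simp_all
    ultimately show ?case by (simp only:)
  next
    case (step v g y)
    have "f (gp_incl V E G v g \<otimes>\<^bsub>P\<^esub> y) = \<alpha> v g \<otimes>\<^bsub>?B\<^esub> f y"
      using hom_mult[OF f(1)] step incl f(2) by simp
    moreover have "f y \<in> Bij (topspace X)"
      using f(1) step by (auto simp: hom_def BijGroup_def)
    ultimately have eq: "f (gp_incl V E G v g \<otimes>\<^bsub>P\<^esub> y) = compose (topspace X) (\<alpha> v g) (f y)"
      using Bij step by (simp add: BijGroup_def)
    have "homeomorphic_map X X (\<alpha> v g)"
      using act step by (auto simp: homeo_action_def)
    then have "homeomorphic_map X X (\<alpha> v g \<circ> f y)"
      using step homeomorphic_map_compose by blast
    then show ?case
      unfolding eq by (rule homeomorphic_map_eq) (simp add: compose_def)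
  qed
  show ?thesis
  proof (rule ex1I, intro conjI ballI)
    let ?\<beta> = "restrict f (carrier P)"
    show "?\<beta> \<in> extensional (carrier P)" by simp
    have "?\<beta> \<in> hom P ?B" using f(1) by (auto simp: hom_def)
    then have "group_action P (topspace X) ?\<beta>"
      by (simp add: group_action_def group_hom_def group_hom_axioms_def group_gp group_BijGroup)
    then show "homeo_action P X ?\<beta>" using homeo by (simp add: homeo_action_def)
    show "?\<beta> (gp_incl V E G v g) = \<alpha> v g" if "v \<in> V" "g \<in> carrier (G v)" for v g
      using that f incl by simp
  next
    fix \<beta>
    assume \<beta>: "\<beta> \<in> extensional (carrier P) \<and> homeo_action P X \<beta>
           \<and> (\<forall>v\<in>V. \<forall>g\<in>carrier (G v). \<beta> (gp_incl V E G v g) = \<alpha> v g)"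
    then have \<beta>hom: "\<beta> \<in> hom P ?B"
      by (auto simp: homeo_action_def group_action_def group_hom_def group_hom_axioms_def)
    have "\<beta> x = f x" if "x \<in> carrier P" for x
      using that
    proof (induction rule: gp_induct)
      case one
      show ?case
        using hom_one[OF f(1) group_gp group_BijGroup] hom_one[OF \<beta>hom group_gp group_BijGroup]
        by simp
    next
      case (step v g y)
      then show ?case
        using hom_mult[OF f(1)] hom_mult[OF \<beta>hom] incl f(2) \<beta> by simp
    qed
    then show "\<beta> = restrict f (carrier P)"
      using \<beta> by (intro extensionalityI[of _ "carrier P"]) auto
  qed
qed

end

end

theory Submission
  imports Defs
begin

text \<open>
  Write \<open>P\<close> for the graph product. The function that does the job sends \<open>(s, x)\<close>, for a shortest
  word \<open>s = g\<^sub>1 \<dots> g\<^sub>k\<close> with letters \<open>g\<^sub>i\<close> in \<open>G\<^bsub>v\<^sub>i\<^esub>\<close>, to the product of the numbers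
  \<open>h\<^bsub>v\<^sub>i\<^esub> (g\<^sub>i, g\<^bsub>i+1\<^esub> \<dots> g\<^sub>k x)\<close>. The main point is that it is positive definite.

  This product is split according to the vertex \<open>v\<close> of a letter, and the factor of one vertex is
  treated by means of a tree. Let \<open>Q\<close> be the subgroup of \<open>P\<close> generated by the groups of the
  vertices other than \<open>v\<close>, and \<open>L\<close> the one generated by the groups of its link, which commutes with
  \<open>G\<^sub>v\<close>. Then \<open>P\<close> is the amalgamated product of \<open>Q\<close> and \<open>L \<times> G\<^sub>v\<close> over \<open>L\<close>, and the cosets of \<open>Q\<close> form
  a tree of cliques: every clique is a copy of \<open>G\<^sub>v\<close>, and distinct cliques meet in at most one
  coset. The points of this tree are alternating words whose letters \<open>(i, g)\<close> consist of a clique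
  through the current point and a nontrivial element of \<open>G\<^sub>v\<close>; the cliques are indexed by cosets
  of \<open>L\<close>. A unital positive semidefinite kernel on every clique extends to a kernel on the whole
  tree by multiplying along geodesics, and the extension is again positive semidefinite, because
  cliques are glued along single points (\<open>clique_tree.pd_tree_kernel\<close>). By its universal property
  \<open>P\<close> acts on these words, and the kernels are equivariant
  (\<open>gp_vertex.tree_kernel_equivariant\<close>); that the functions \<open>h\<^sub>v\<close> are invariant under the link of \<open>v\<close>
  is exactly what makes the kernel of a clique well defined. So the kernel between the root and
  its translate by \<open>s\<close> is a positive definite function, and on shortest words it is the product
  over the letters of vertex \<open>v\<close> (\<open>gp_vertex.vertex_factor_geodesic\<close>). For the function above it
  remains to multiply over the vertices, by the Schur product theorem \<open>psd_matrix_mult\<close>.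

  For the decay at infinity, \<open>h\<^sub>v\<close> is first multiplied by a constant \<open>r < 1\<close> at nontrivial group
  elements, which makes the product small on long words. At stage \<open>n\<close> the constant is \<open>0\<close> for all
  but finitely many of the vertices with nontrivial group, of which there are countably many since
  \<open>P\<close> is countable. Hence only finitely many words have a large value. As the constants tend to
  \<open>1\<close> for each vertex, convergence to \<open>1\<close> on compact sets is inherited from the factors.
\<close>

section \<open>Positive semidefinite kernels\<close>

text \<open>The quantification is over sequences of points, possibly with repetitions, rather than over
  finite subsets: the pullback of such a kernel along any map is then trivially of the same kind.\<close>

definition pd_kernel :: "'s set \<Rightarrow> ('s \<Rightarrow> 's \<Rightarrow> complex) \<Rightarrow> bool" where
  "pd_kernel S k \<longleftrightarrow>
     (\<forall>n. \<forall>s :: nat \<Rightarrow> 's. (\<forall>i<n. s i \<in> S) \<longrightarrow> psd_matrix n (\<lambda>i j. k (s i) (s j)))"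

lemma psd_matrixD:
  "psd_matrix n A \<Longrightarrow> (\<Sum>i<n. \<Sum>j<n. cnj (c i) * A i j * c j) \<in> \<real>\<^sub>\<ge>\<^sub>0"
  by (simp add: psd_matrix_def)

lemma psd_matrix_cong:
  "(\<And>i j. i < n \<Longrightarrow> j < n \<Longrightarrow> A i j = B i j) \<Longrightarrow> psd_matrix n A \<longleftrightarrow> psd_matrix n B"
proof -
  assume "\<And>i j. i < n \<Longrightarrow> j < n \<Longrightarrow> A i j = B i j"
  then have "(\<Sum>i<n. \<Sum>j<n. cnj (c i) * A i j * c j) = (\<Sum>i<n. \<Sum>j<n. cnj (c i) * B i j * c j)" for c
    by (intro sum.cong) auto
  then show ?thesis by (simp add: psd_matrix_def)
qed

lemma psd_matrix_add:
  assumes "psd_matrix n A" "psd_matrix n B"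
  shows "psd_matrix n (\<lambda>i j. A i j + B i j)"
  unfolding psd_matrix_def
proof
  fix c
  have "(\<Sum>i<n. \<Sum>j<n. cnj (c i) * (A i j + B i j) * c j)
      = (\<Sum>i<n. \<Sum>j<n. cnj (c i) * A i j * c j) + (\<Sum>i<n. \<Sum>j<n. cnj (c i) * B i j * c j)"
    by (simp add: algebra_simps sum.distrib)
  then show "(\<Sum>i<n. \<Sum>j<n. cnj (c i) * (A i j + B i j) * c j) \<in> \<real>\<^sub>\<ge>\<^sub>0"
    by (simp only: nonneg_Reals_add_I psd_matrixD[OF assms(1)] psd_matrixD[OF assms(2)])
qed

lemma psd_matrix_sum:
  "finite B \<Longrightarrow> (\<And>b. b \<in> B \<Longrightarrow> psd_matrix n (A b)) \<Longrightarrow> psd_matrix n (\<lambda>i j. \<Sum>b\<in>B. A b i j)"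
  by (induction rule: finite_induct) (auto simp: psd_matrix_add, simp add: psd_matrix_def)

lemma psd_matrix_scale:
  assumes "psd_matrix n A"
  shows "psd_matrix n (\<lambda>i j. cnj (f i) * A i j * f j)"
  unfolding psd_matrix_def
proof
  fix c
  show "(\<Sum>i<n. \<Sum>j<n. cnj (c i) * (cnj (f i) * A i j * f j) * c j) \<in> \<real>\<^sub>\<ge>\<^sub>0"
    using psd_matrixD[OF assms, of "\<lambda>i. f i * c i"] by (simp add: mult_ac)
qed

lemma psd_matrix_pullback:
  assumes A: "psd_matrix n A" and f: "\<And>i. i < m \<Longrightarrow> f i < n"
  shows "psd_matrix m (\<lambda>i j. A (f i) (f j))"
  unfolding psd_matrix_def
proof
  fix c :: "nat \<Rightarrow> complex"
  \<comment> \<open>Adding up the weights over the fibres of \<open>f\<close> gives the same value of the quadratic form of \<open>A\<close>.\<close>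
  define d where "d p = (\<Sum>i\<in>{i\<in>{..<m}. f i = p}. c i)" for p
  have f': "f ` {..<m} \<subseteq> {..<n}" using f by auto
  have inner: "(\<Sum>q<n. A p q * d q) = (\<Sum>j<m. A p (f j) * c j)" for p
  proof -
    have "(\<Sum>j<m. A p (f j) * c j) = (\<Sum>q<n. \<Sum>j\<in>{j\<in>{..<m}. f j = q}. A p (f j) * c j)"
      by (rule sum.group[symmetric]) (use f' in auto)
    then show ?thesis by (simp add: d_def sum_distrib_left)
  qed
  have "(\<Sum>p<n. \<Sum>q<n. cnj (d p) * A p q * d q) = (\<Sum>p<n. cnj (d p) * (\<Sum>j<m. A p (f j) * c j))"
    by (simp add: inner[symmetric] sum_distrib_left mult.assoc)
  also have "\<dots> = (\<Sum>p<n. \<Sum>i\<in>{i\<in>{..<m}. f i = p}. cnj (c i) * (\<Sum>j<m. A (f i) (f j) * c j))"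
    by (simp add: d_def sum_distrib_right)
  also have "\<dots> = (\<Sum>i<m. cnj (c i) * (\<Sum>j<m. A (f i) (f j) * c j))"
    by (rule sum.group) (use f' in auto)
  also have "\<dots> = (\<Sum>i<m. \<Sum>j<m. cnj (c i) * A (f i) (f j) * c j)"
    by (simp add: sum_distrib_left mult.assoc)
  finally show "(\<Sum>i<m. \<Sum>j<m. cnj (c i) * A (f i) (f j) * c j) \<in> \<real>\<^sub>\<ge>\<^sub>0"
    using psd_matrixD[OF A, of d] by simp
qed

lemma psd_matrix_two:
  assumes A: "psd_matrix n A" and ij: "i < n" "j < n"
  shows "cnj a * A i i * a + cnj a * A i j * b + cnj b * A j i * a + cnj b * A j j * b \<in> \<real>\<^sub>\<ge>\<^sub>0"
proof -
  have "psd_matrix 2 (\<lambda>p q. A (if p = 0 then i else j) (if q = 0 then i else j))"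
    by (rule psd_matrix_pullback[OF A]) (use ij in auto)
  from psd_matrixD[OF this, of "\<lambda>p. if p = 0 then a else b"]
  show ?thesis by (simp add: lessThan_nat_numeral add_ac)
qed

lemma psd_matrix_diag:
  assumes "psd_matrix n A" "i < n"
  shows "A i i \<in> \<real>\<^sub>\<ge>\<^sub>0"
  using psd_matrix_two[OF assms(1,2,2), of 1 0] by simp

lemma psd_matrix_hermitian:
  assumes A: "psd_matrix n A" and ij: "i < n" "j < n"
  shows "A j i = cnj (A i j)"
proof -
  have d: "Im (A i i) = 0" "Im (A j j) = 0"
    using psd_matrix_diag[OF A] ij by (auto simp: complex_nonneg_Reals_iff)
  have "Im (A i j) + Im (A j i) = 0"
    using psd_matrix_two[OF A ij, of 1 1] d by (simp add: complex_nonneg_Reals_iff)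
  moreover have "Re (A i j) - Re (A j i) = 0"
    using psd_matrix_two[OF A ij, of 1 \<i>] d by (simp add: complex_nonneg_Reals_iff)
  ultimately show ?thesis by (simp add: complex_eq_iff)
qed

text \<open>The \<open>2 \<times> 2\<close> minor on \<open>i\<close> and \<open>j\<close> has determinant \<open>- \<bar>A i j\<bar>\<^sup>2\<close>. The proof evaluates the quadratic
  form at a vector whose first coordinate is a large multiple of \<open>- A i j\<close>.\<close>

lemma psd_matrix_zero_row:
  assumes A: "psd_matrix n A" and ij: "i < n" "j < n" and 0: "A i i = 0"
  shows "A i j = 0"
proof (rule ccontr)
  assume ne: "A i j \<noteq> 0"
  define r where "r = Re (A j j)"
  define s where "s = (cmod (A i j))\<^sup>2"
  have s: "s > 0" using ne by (simp add: s_def)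
  define t where "t = (r + 1) / s"
  have *: "A i j * cnj (A i j) = complex_of_real s"
    by (simp only: s_def complex_norm_square)
  have "cnj (- of_real t * A i j) * A i j + cnj (A i j) * (- of_real t * A i j) + A j j \<in> \<real>\<^sub>\<ge>\<^sub>0"
    using psd_matrix_two[OF A ij, of "- of_real t * A i j" 1] psd_matrix_hermitian[OF A ij] 0 by simp
  also have "cnj (- of_real t * A i j) * A i j + cnj (A i j) * (- of_real t * A i j) + A j j
      = A j j - 2 * of_real t * (A i j * cnj (A i j))"
    by (simp add: algebra_simps)
  also have "\<dots> = A j j - of_real (2 * (r + 1))"
    using s by (simp add: * t_def)
  finally have "r - 2 * (r + 1) \<ge> 0"
    by (simp add: complex_nonneg_Reals_iff r_def)
  moreover have "r \<ge> 0"
    using psd_matrix_diag[OF A ij(2)] by (simp add: complex_nonneg_Reals_iff r_def)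
  ultimately show False by simp
qed

text \<open>The quadratic form of the complement at \<open>c\<close> is the minimum of the form of \<open>A\<close> over all
  extensions of \<open>c\<close> by a last coordinate \<open>z\<close>, attained at \<open>z = - (\<Sum>j<n. A n j * c j) / A n n\<close>. If
  \<open>A n n = 0\<close>, division by zero makes the complement equal to \<open>A\<close> itself.\<close>

lemma psd_matrix_schur_complement:
  assumes A: "psd_matrix (Suc n) A"
  shows "psd_matrix n (\<lambda>i j. A i j - A i n * A n j / A n n)"
proof (cases "A n n = 0")
  case True
  then show ?thesis
    using psd_matrix_pullback[OF A, of n "\<lambda>i. i"] by simp
next
  case False
  have r: "cnj (A n n) = A n n" using psd_matrix_hermitian[OF A, of n n] by simp
  show ?thesis
    unfolding psd_matrix_def
  proof
    fix c :: "nat \<Rightarrow> complex"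
    define l where "l = (\<Sum>j<n. A n j * c j)"
    define z where "z = - l / A n n"
    define q where "q = (\<Sum>i<n. \<Sum>j<n. cnj (c i) * A i j * c j)"
    have lc: "(\<Sum>i<n. cnj (c i) * A i n) = cnj l"
      unfolding l_def cnj_sum
      by (intro sum.cong refl) (use psd_matrix_hermitian[OF A, of _ n] in \<open>auto simp: mult.commute\<close>)
    have "(\<Sum>i<Suc n. \<Sum>j<Suc n. cnj ((c(n := z)) i) * A i j * (c(n := z)) j)
        = q + (\<Sum>i<n. cnj (c i) * A i n) * z + cnj z * l + cnj z * A n n * z"
      by (simp add: q_def l_def sum.distrib sum_distrib_left sum_distrib_right mult.assoc)
    also have "\<dots> = q - cnj l * l / A n n"
      unfolding lc using False by (simp add: z_def r field_simps)
    also have "\<dots> = (\<Sum>i<n. \<Sum>j<n. cnj (c i) * (A i j - A i n * A n j / A n n) * c j)"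
    proof -
      have "cnj l * l / A n n = (\<Sum>i<n. \<Sum>j<n. cnj (c i) * (A i n * A n j / A n n) * c j)"
        unfolding lc[symmetric] unfolding l_def
        by (simp only: sum_product sum_divide_distrib) (simp add: mult_ac)
      then show ?thesis by (simp add: q_def algebra_simps sum_subtractf)
    qed
    finally show "(\<Sum>i<n. \<Sum>j<n. cnj (c i) * (A i j - A i n * A n j / A n n) * c j) \<in> \<real>\<^sub>\<ge>\<^sub>0"
      using psd_matrixD[OF A, of "c(n := z)"] by simp
  qed
qed

text \<open>Schur product theorem. Splitting off the last column, \<open>B\<close> is the sum of a matrix of rank one
  and of a positive semidefinite \<open>C\<close> with vanishing last row and column. The entrywise product of \<open>A\<close>
  with the former is a rescaling of \<open>A\<close>, and the product with \<open>C\<close> is covered by the induction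
  hypothesis.\<close>

lemma psd_matrix_mult:
  assumes "psd_matrix n A" "psd_matrix n B"
  shows "psd_matrix n (\<lambda>i j. A i j * B i j)"
  using assms
proof (induction n arbitrary: B)
  case 0
  then show ?case by (simp add: psd_matrix_def)
next
  case (Suc n)
  define C where "C i j = B i j - B i n * B n j / B n n" for i j
  have herm: "B i n = cnj (B n i)" if "i \<le> n" for i
    using psd_matrix_hermitian[OF Suc.prems(2), of n i] that by simp
  define b where "b = sqrt (Re (B n n))"
  have Bnn: "B n n = of_real b * of_real b"
    using psd_matrix_diag[OF Suc.prems(2), of n]
    by (simp add: b_def complex_nonneg_Reals_iff complex_eq_iff flip: of_real_mult)
  have A: "psd_matrix n A"
    using psd_matrix_pullback[OF Suc.prems(1), of n "\<lambda>i. i"] by simp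
  have "psd_matrix n C" unfolding C_def[abs_def]
    by (rule psd_matrix_schur_complement) (rule Suc.prems)
  from Suc.IH[OF A this] have AC: "psd_matrix n (\<lambda>i j. A i j * C i j)" .
  have C0: "C i n = 0 \<and> C n i = 0" if "i \<le> n" for i
  proof (cases "B n n = 0")
    case True
    then have "B n i = 0" using psd_matrix_zero_row[OF Suc.prems(2), of n i] that by simp
    then show ?thesis using True herm[OF that] by (simp add: C_def)
  qed (simp add: C_def)
  have "psd_matrix (Suc n) (\<lambda>i j. A i j * C i j)"
    using AC C0 by (simp add: psd_matrix_def)
  moreover have "psd_matrix (Suc n) (\<lambda>i j. cnj (B n i / of_real b) * A i j * (B n j / of_real b))"
    by (rule psd_matrix_scale) (rule Suc.prems)
  ultimately have "psd_matrix (Suc n)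
      (\<lambda>i j. A i j * C i j + cnj (B n i / of_real b) * A i j * (B n j / of_real b))"
    by (rule psd_matrix_add)
  then show ?case
    by (rule iffD1[OF psd_matrix_cong, rotated])
      (simp add: C_def herm Bnn algebra_simps)
qed

lemma pd_kernelD:
  "pd_kernel S k \<Longrightarrow> (\<And>i. i < n \<Longrightarrow> s i \<in> S) \<Longrightarrow> psd_matrix n (\<lambda>i j. k (s i) (s j))"
  by (simp add: pd_kernel_def)

lemma pd_kernel_cong:
  assumes "\<And>s t. s \<in> S \<Longrightarrow> t \<in> S \<Longrightarrow> k s t = l s t"
  shows "pd_kernel S k \<longleftrightarrow> pd_kernel S l"
proof -
  have "psd_matrix n (\<lambda>i j. k (s i) (s j)) \<longleftrightarrow> psd_matrix n (\<lambda>i j. l (s i) (s j))"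
    if "\<forall>i<n. s i \<in> S" for n and s :: "nat \<Rightarrow> 'a"
    using that assms by (intro psd_matrix_cong) simp
  then show ?thesis by (auto simp: pd_kernel_def)
qed

lemma pd_kernel_pullback:
  assumes k: "pd_kernel S k" and f: "\<And>t. t \<in> T \<Longrightarrow> f t \<in> S"
  shows "pd_kernel T (\<lambda>s t. k (f s) (f t))"
  unfolding pd_kernel_def
proof (intro allI impI)
  fix n and s :: "nat \<Rightarrow> 'b" assume "\<forall>i<n. s i \<in> T"
  then show "psd_matrix n (\<lambda>i j. k (f (s i)) (f (s j)))"
    using pd_kernelD[OF k, of n "\<lambda>i. f (s i)"] f by simp
qed

lemma pd_kernel_add:
  "pd_kernel S k \<Longrightarrow> pd_kernel S l \<Longrightarrow> pd_kernel S (\<lambda>s t. k s t + l s t)"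
  unfolding pd_kernel_def by (simp add: psd_matrix_add)

lemma pd_kernel_mult:
  "pd_kernel S k \<Longrightarrow> pd_kernel S l \<Longrightarrow> pd_kernel S (\<lambda>s t. k s t * l s t)"
  unfolding pd_kernel_def by (simp add: psd_matrix_mult)

lemma pd_kernel_scale:
  "pd_kernel S k \<Longrightarrow> pd_kernel S (\<lambda>s t. cnj (f s) * k s t * f t)"
  unfolding pd_kernel_def by (auto intro: psd_matrix_scale)

lemma pd_kernel_const: "pd_kernel S (\<lambda>_ _. 1)"
proof -
  have "(\<Sum>i<n. \<Sum>j<n. cnj (c i) * 1 * c j) \<in> \<real>\<^sub>\<ge>\<^sub>0" for n and c :: "nat \<Rightarrow> complex"
  proof -
    have "(\<Sum>i<n. \<Sum>j<n. cnj (c i) * 1 * c j) = cnj (\<Sum>i<n. c i) * (\<Sum>j<n. c j)"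
      by (simp add: sum_product)
    also have "\<dots> = of_real ((cmod (\<Sum>j<n. c j))\<^sup>2)"
      by (metis complex_norm_square mult.commute)
    finally show ?thesis by (simp del: of_real_power)
  qed
  then show ?thesis by (simp add: pd_kernel_def psd_matrix_def)
qed

lemma pd_kernel_prod:
  "finite B \<Longrightarrow> (\<And>b. b \<in> B \<Longrightarrow> pd_kernel S (k b)) \<Longrightarrow> pd_kernel S (\<lambda>s t. \<Prod>b\<in>B. k b s t)"
  by (induction rule: finite_induct) (auto simp: pd_kernel_mult pd_kernel_const)

lemma pd_kernel_diagonal_blocks:
  assumes "\<And>b. b \<in> f ` S \<Longrightarrow> pd_kernel {s \<in> S. f s = b} k"
  shows "pd_kernel S (\<lambda>s t. if f s = f t then k s t else 0)"
  unfolding pd_kernel_def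
proof (intro allI impI)
  fix n and s :: "nat \<Rightarrow> _"
  assume s: "\<forall>i<n. s i \<in> S"
  define u where "u b i = (if f (s i) = b then 1 else 0 :: complex)" for b i
  have "psd_matrix n (\<lambda>i j. cnj (u b i) * k (s i) (s j) * u b j)" if "b \<in> (f \<circ> s) ` {..<n}" for b
  proof -
    obtain p where p: "p < n" "f (s p) = b" using \<open>b \<in> (f \<circ> s) ` {..<n}\<close> by auto
    \<comment> \<open>Positions outside the block get weight zero, so they may be moved into it.\<close>
    define r where "r i = (if f (s i) = b then s i else s p)" for i
    have "psd_matrix n (\<lambda>i j. k (r i) (r j))"
      using p s by (intro pd_kernelD[OF assms[of b]]) (auto simp: r_def)
    then have "psd_matrix n (\<lambda>i j. cnj (u b i) * k (r i) (r j) * u b j)"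
      by (rule psd_matrix_scale)
    moreover have "cnj (u b i) * k (r i) (r j) * u b j = cnj (u b i) * k (s i) (s j) * u b j" for i j
      by (simp add: u_def r_def)
    ultimately show ?thesis by simp
  qed
  then have "psd_matrix n (\<lambda>i j. \<Sum>b\<in>(f \<circ> s) ` {..<n}. cnj (u b i) * k (s i) (s j) * u b j)"
    by (intro psd_matrix_sum) auto
  then show "psd_matrix n (\<lambda>i j. if f (s i) = f (s j) then k (s i) (s j) else 0)"
  proof (rule iffD1[OF psd_matrix_cong, rotated])
    fix i j assume "i < n" "j < n"
    then have "(\<Sum>b\<in>(f \<circ> s) ` {..<n}. cnj (u b i) * k (s i) (s j) * u b j)
      = (\<Sum>b\<in>{f (s i)}. cnj (u b i) * k (s i) (s j) * u b j)"
      by (intro sum.mono_neutral_right) (auto simp: u_def)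
    then show "(\<Sum>b\<in>(f \<circ> s) ` {..<n}. cnj (u b i) * k (s i) (s j) * u b j)
      = (if f (s i) = f (s j) then k (s i) (s j) else 0)"
      by (simp add: u_def)
  qed
qed

lemma pd_kernel_hermitian:
  assumes "pd_kernel S k" "s \<in> S" "t \<in> S"
  shows "k t s = cnj (k s t)"
  using psd_matrix_hermitian[OF pd_kernelD[OF assms(1), of 2 "\<lambda>i. if i = 0 then s else t"], of 0 1]
    assms by simp

text \<open>If \<open>k s t\<close> is the inner product of vectors \<open>\<xi>\<^sub>s\<close> and \<open>\<xi>\<^sub>t\<close>, this kernel belongs to the projections
  of these vectors to the orthogonal complement of the unit vector \<open>\<xi>\<^sub>e\<close>.\<close>

lemma pd_kernel_remove_point:
  assumes k: "pd_kernel S k" and e: "e \<in> S" "k e e = 1"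
  shows "pd_kernel S (\<lambda>s t. k s t - cnj (k e s) * k e t)"
  unfolding pd_kernel_def
proof (intro allI impI)
  fix n and s :: "nat \<Rightarrow> 'a"
  assume s: "\<forall>i<n. s i \<in> S"
  have "psd_matrix (Suc n) (\<lambda>i j. k ((s(n := e)) i) ((s(n := e)) j))"
    by (rule pd_kernelD[OF k]) (use s e in auto)
  from psd_matrix_schur_complement[OF this]
  show "psd_matrix n (\<lambda>i j. k (s i) (s j) - cnj (k e (s i)) * k e (s j))"
    by (rule iffD1[OF psd_matrix_cong, rotated])
      (simp add: e pd_kernel_hermitian[OF k e(1) s[rule_format]])
qed

lemma pd_kernel_norm_le_1:
  assumes k: "pd_kernel S k" and "s \<in> S" "t \<in> S" "k s s = 1" "k t t = 1"
  shows "cmod (k s t) \<le> 1"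
proof -
  have "k t t - cnj (k s t) * k s t \<in> \<real>\<^sub>\<ge>\<^sub>0"
    using psd_matrix_diag[OF pd_kernelD[OF pd_kernel_remove_point[OF k assms(2,4)], of 1 "\<lambda>_. t"], of 0]
      assms by simp
  moreover have "cnj (k s t) * k s t = of_real ((cmod (k s t))\<^sup>2)"
    by (metis complex_norm_square mult.commute)
  ultimately have "(cmod (k s t))\<^sup>2 \<le> 1\<^sup>2"
    using assms by (simp add: complex_nonneg_Reals_iff)
  then show ?thesis by (rule power2_le_imp_le) simp
qed

section \<open>Kernels on trees of cliques\<close>

text \<open>The points of the tree are words of letters \<open>(i, g)\<close>: from the current point, move inside the
  clique \<open>i\<close>, a copy of \<open>K\<close> with the current point at its neutral element, to the point \<open>g\<close>. The kernel on
  the clique \<open>i\<close> is \<open>\<kappa> i y\<close>. It depends on a parameter \<open>y\<close>, seen from the current point: a move by \<open>g\<close>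
  replaces \<open>y\<close> by \<open>A i (inv g) y\<close>. Only words that never use the same clique twice in a row and no neutral
  letter (\<open>reduced\<close> below) represent points uniquely.\<close>

locale clique_tree = group K for K :: "('g, 'm) monoid_scheme" (structure) +
  fixes I :: "'i set" and Y :: "'y set"
    and A :: "'i \<Rightarrow> 'g \<Rightarrow> 'y \<Rightarrow> 'y"
    and \<kappa> :: "'i \<Rightarrow> 'y \<Rightarrow> 'g \<Rightarrow> 'g \<Rightarrow> complex"
  assumes A_closed: "\<lbrakk>i \<in> I; g \<in> carrier K; y \<in> Y\<rbrakk> \<Longrightarrow> A i g y \<in> Y"
    and A_one: "\<lbrakk>i \<in> I; y \<in> Y\<rbrakk> \<Longrightarrow> A i \<one> y = y"
    and A_mult: "\<lbrakk>i \<in> I; g \<in> carrier K; g' \<in> carrier K; y \<in> Y\<rbrakk>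
                   \<Longrightarrow> A i (g \<otimes> g') y = A i g (A i g' y)"
    and \<kappa>_pd: "\<lbrakk>i \<in> I; y \<in> Y\<rbrakk> \<Longrightarrow> pd_kernel (carrier K) (\<kappa> i y)"
    and \<kappa>_one: "\<lbrakk>i \<in> I; y \<in> Y\<rbrakk> \<Longrightarrow> \<kappa> i y \<one> \<one> = 1"
    and \<kappa>_equivariant: "\<lbrakk>i \<in> I; g \<in> carrier K; a \<in> carrier K; b \<in> carrier K; y \<in> Y\<rbrakk>
                   \<Longrightarrow> \<kappa> i (A i g y) (g \<otimes> a) (g \<otimes> b) = \<kappa> i y a b"
begin

text \<open>The product of the clique kernels along the path from the root to \<open>w\<close>.\<close>

fun coeff :: "'y \<Rightarrow> ('i \<times> 'g) list \<Rightarrow> complex" where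
  "coeff y [] = 1"
| "coeff y ((i, g) # w) = \<kappa> i y \<one> g * coeff (A i (inv g) y) w"

text \<open>The tree kernel after projecting away from the root, as in \<open>pd_kernel_remove_point\<close>. With
  vectors \<open>\<xi>\<^sub>w\<close> as there, \<open>\<xi>\<^sub>w\<close> decomposes orthogonally into contributions of the prefixes of \<open>w\<close>, and
  two words only share contributions of a common prefix followed by letters from the same clique.\<close>

fun branch_kernel :: "'y \<Rightarrow> ('i \<times> 'g) list \<Rightarrow> ('i \<times> 'g) list \<Rightarrow> complex" where
  "branch_kernel y ((i, a) # w) ((j, b) # w') =
     (if i = j then
        cnj (coeff (A i (inv a) y) w) * (\<kappa> i y a b - cnj (\<kappa> i y \<one> a) * \<kappa> i y \<one> b)
          * coeff (A i (inv b) y) w'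
        + (if a = b then branch_kernel (A i (inv a) y) w w' else 0)
      else 0)"
| "branch_kernel y _ _ = 0"

definition tree_kernel :: "'y \<Rightarrow> ('i \<times> 'g) list \<Rightarrow> ('i \<times> 'g) list \<Rightarrow> complex" where
  "tree_kernel y w w' = cnj (coeff y w) * coeff y w' + branch_kernel y w w'"

text \<open>Induction on the length: words starting in different cliques are orthogonal, and within one
  clique the kernel is the projected clique kernel, rescaled, plus branch kernels of shorter words
  that start with the same letter.\<close>

lemma pd_branch_kernel:
  "y \<in> Y \<Longrightarrow> pd_kernel {w \<in> lists (I \<times> carrier K). length w \<le> n} (branch_kernel y)"
proof (induction n arbitrary: y)
  case 0
  have "pd_kernel {w \<in> lists (I \<times> carrier K). length w \<le> 0} (\<lambda>_ _. 0)"
    by (simp add: pd_kernel_def psd_matrix_def)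
  then show ?case by (rule iffD1[OF pd_kernel_cong, rotated]) auto
next
  case (Suc n)
  let ?S = "{w \<in> lists (I \<times> carrier K). length w \<le> Suc n}"
  let ?f = "\<lambda>w :: ('i \<times> 'g) list. map_option fst (if w = [] then None else Some (hd w))"
  have "pd_kernel {w \<in> ?S. ?f w = b} (branch_kernel y)" if "b \<in> ?f ` ?S" for b
  proof (cases b)
    case None
    have "pd_kernel {w \<in> ?S. ?f w = b} (\<lambda>_ _. 0)"
      by (simp add: pd_kernel_def psd_matrix_def)
    then show ?thesis
      by (rule iffD1[OF pd_kernel_cong, rotated]) (auto simp: None split: if_splits)
  next
    case (Some i)
    have i: "i \<in> I" using that Some by (auto split: if_splits simp: neq_Nil_conv)
    define T where "T = {w \<in> ?S. ?f w = b}"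
    define head where "head w = snd (hd w)" for w :: "('i \<times> 'g) list"
    have T: "w = (i, head w) # tl w" "head w \<in> carrier K"
      "tl w \<in> {w \<in> lists (I \<times> carrier K). length w \<le> n}" if "w \<in> T" for w
      using that Some by (cases w; auto simp: T_def head_def)+
    define c2 where "c2 w = coeff (A i (inv (head w)) y) (tl w)" for w
    have "pd_kernel (carrier K) (\<lambda>a b. \<kappa> i y a b - cnj (\<kappa> i y \<one> a) * \<kappa> i y \<one> b)"
      using pd_kernel_remove_point[OF \<kappa>_pd[OF i Suc.prems]] \<kappa>_one[OF i Suc.prems] by simp
    then have "pd_kernel T (\<lambda>w w'. \<kappa> i y (head w) (head w')
                - cnj (\<kappa> i y \<one> (head w)) * \<kappa> i y \<one> (head w'))"
      by (rule pd_kernel_pullback[of _ _ _ head]) (rule T)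
    then have 1: "pd_kernel T (\<lambda>w w'. cnj (c2 w) * (\<kappa> i y (head w) (head w')
                - cnj (\<kappa> i y \<one> (head w)) * \<kappa> i y \<one> (head w')) * c2 w')"
      by (rule pd_kernel_scale)
    have 2: "pd_kernel T (\<lambda>w w'. if head w = head w'
                then branch_kernel (A i (inv (head w)) y) (tl w) (tl w') else 0)"
    proof (rule pd_kernel_diagonal_blocks)
      fix a assume "a \<in> head ` T"
      then have a: "a \<in> carrier K" using T(2) by blast
      have "pd_kernel {w \<in> T. head w = a} (\<lambda>w w'. branch_kernel (A i (inv a) y) (tl w) (tl w'))"
      proof (rule pd_kernel_pullback[OF Suc.IH])
        show "A i (inv a) y \<in> Y" using i a Suc.prems by (simp add: A_closed)
      qed (use T(3) in blast)
      then show "pd_kernel {w \<in> T. head w = a}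
          (\<lambda>w w'. branch_kernel (A i (inv (head w)) y) (tl w) (tl w'))"
        by (rule iffD1[OF pd_kernel_cong, rotated]) simp
    qed
    have "branch_kernel y w w' = cnj (c2 w) * (\<kappa> i y (head w) (head w')
                - cnj (\<kappa> i y \<one> (head w)) * \<kappa> i y \<one> (head w')) * c2 w'
            + (if head w = head w' then branch_kernel (A i (inv (head w)) y) (tl w) (tl w') else 0)"
      if "w \<in> T" "w' \<in> T" for w w'
      by (subst T(1)[OF that(1)], subst T(1)[OF that(2)]) (simp add: c2_def)
    then have "pd_kernel T (branch_kernel y)"
      by (intro iffD1[OF pd_kernel_cong pd_kernel_add[OF 1 2]]) simp
    then show ?thesis by (simp only: T_def)
  qed
  then have "pd_kernel ?S (\<lambda>w w'. if ?f w = ?f w' then branch_kernel y w w' else 0)"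
    by (rule pd_kernel_diagonal_blocks)
  moreover have "(if ?f w = ?f w' then branch_kernel y w w' else 0) = branch_kernel y w w'" for w w'
    by (cases "(y, w, w')" rule: branch_kernel.cases) auto
  ultimately show ?case by simp
qed

lemma pd_tree_kernel:
  assumes "y \<in> Y"
  shows "pd_kernel (lists (I \<times> carrier K)) (tree_kernel y)"
  unfolding tree_kernel_def[abs_def]
proof (rule pd_kernel_add)
  show "pd_kernel (lists (I \<times> carrier K)) (\<lambda>w w'. cnj (coeff y w) * coeff y w')"
    using pd_kernel_scale[OF pd_kernel_const, of _ "coeff y"] by simp
  show "pd_kernel (lists (I \<times> carrier K)) (branch_kernel y)"
    unfolding pd_kernel_def
  proof (intro allI impI)
    fix n and s :: "nat \<Rightarrow> ('i \<times> 'g) list" assume s: "\<forall>i<n. s i \<in> lists (I \<times> carrier K)"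
    have "length (s i) \<le> (\<Sum>i<n. length (s i))" if "i < n" for i
      using that by (intro member_le_sum) auto
    then show "psd_matrix n (\<lambda>i j. branch_kernel y (s i) (s j))"
      using s by (intro pd_kernelD[OF pd_branch_kernel[OF assms, of "\<Sum>i<n. length (s i)"]]) auto
  qed
qed

lemma tree_kernel_root: "tree_kernel y [] w = coeff y w"
  by (simp add: tree_kernel_def)

fun starts_with :: "'i \<Rightarrow> ('i \<times> 'g) list \<Rightarrow> bool" where
  "starts_with i [] = False"
| "starts_with i ((j, g) # w) = (j = i)"

fun reduced :: "('i \<times> 'g) list \<Rightarrow> bool" where
  "reduced [] = True"
| "reduced ((i, g) # w) \<longleftrightarrow> i \<in> I \<and> g \<in> carrier K \<and> g \<noteq> \<one> \<and> reduced w \<and> \<not> starts_with i w"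

text \<open>\<open>attach i\<close> also covers the point at the neutral element of the clique \<open>i\<close>. Thus every reduced word
  is uniquely \<open>attach i a u\<close> with \<open>u\<close> not starting in \<open>i\<close>, and left multiplication in \<open>i\<close> only changes \<open>a\<close>.\<close>

definition attach :: "'i \<Rightarrow> 'g \<Rightarrow> ('i \<times> 'g) list \<Rightarrow> ('i \<times> 'g) list" where
  "attach i g w = (if g = \<one> then w else (i, g) # w)"

definition left_mult :: "'i \<Rightarrow> 'g \<Rightarrow> ('i \<times> 'g) list \<Rightarrow> ('i \<times> 'g) list" where
  "left_mult i g w =
     (if starts_with i w then attach i (g \<otimes> snd (hd w)) (tl w) else attach i g w)"

lemma reduced_lists: "reduced w \<Longrightarrow> w \<in> lists (I \<times> carrier K)"
  by (induction w rule: reduced.induct) auto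

lemma reduced_attach:
  "\<lbrakk>i \<in> I; g \<in> carrier K; reduced w; \<not> starts_with i w\<rbrakk> \<Longrightarrow> reduced (attach i g w)"
  by (simp add: attach_def)

lemma reduced_attach_cases:
  assumes "reduced w" "i \<in> I"
  obtains a u where "a \<in> carrier K" "reduced u" "\<not> starts_with i u" "w = attach i a u"
proof (cases "starts_with i w")
  case True
  then obtain a u where w: "w = (i, a) # u" by (cases w) auto
  show ?thesis using assms by (intro that[of a u]) (auto simp: w attach_def)
next
  case False
  then show ?thesis using assms by (intro that[of \<one> w]) (auto simp: attach_def)
qed

lemma left_mult_attach:
  assumes "i \<in> I" "g \<in> carrier K" "a \<in> carrier K" "\<not> starts_with i u"
  shows "left_mult i g (attach i a u) = attach i (g \<otimes> a) u"
  using assms by (auto simp: left_mult_def attach_def)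

lemma reduced_left_mult:
  assumes "i \<in> I" "g \<in> carrier K" "reduced w"
  shows "reduced (left_mult i g w)"
  using assms(3,1)
  by (rule reduced_attach_cases) (use assms in \<open>auto simp: left_mult_attach reduced_attach\<close>)

lemma left_mult_one:
  assumes "i \<in> I" "reduced w"
  shows "left_mult i \<one> w = w"
  using assms(2,1) by (rule reduced_attach_cases) (use assms in \<open>auto simp: left_mult_attach\<close>)

lemma left_mult_mult:
  assumes "i \<in> I" "reduced w" "g \<in> carrier K" "g' \<in> carrier K"
  shows "left_mult i (g \<otimes> g') w = left_mult i g (left_mult i g' w)"
  using assms(2,1)
  by (rule reduced_attach_cases) (use assms in \<open>auto simp: left_mult_attach m_assoc\<close>)

lemma coeff_attach:
  assumes "i \<in> I" "y \<in> Y" "a \<in> carrier K"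
  shows "coeff y (attach i a w) = \<kappa> i y \<one> a * coeff (A i (inv a) y) w"
  using assms by (simp add: attach_def \<kappa>_one A_one)

text \<open>A formula that treats all points of the clique at the root alike, including the root; this
  symmetry is the reason for \<open>tree_kernel_left_mult\<close>.\<close>

lemma tree_kernel_attach:
  assumes i: "i \<in> I" and y: "y \<in> Y" and ab: "a \<in> carrier K" "b \<in> carrier K"
    and w: "\<not> starts_with i w" "\<not> starts_with i w'"
  shows "tree_kernel y (attach i a w) (attach i b w')
    = cnj (coeff (A i (inv a) y) w) * \<kappa> i y a b * coeff (A i (inv b) y) w'
      + (if a = b then branch_kernel (A i (inv a) y) w w' else 0)"
proof -
  have herm: "\<kappa> i y a \<one> = cnj (\<kappa> i y \<one> a)"
    using pd_kernel_hermitian[OF \<kappa>_pd[OF i y], of \<one> a] ab by simp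
  have "branch_kernel y ((i, g) # u) u' = 0 \<and> branch_kernel y u' ((i, g) # u) = 0"
    if "\<not> starts_with i u'" for g u u'
    using that by (cases u') auto
  then show ?thesis
    using assms herm by (auto simp: tree_kernel_def attach_def \<kappa>_one A_one algebra_simps)
qed

lemma tree_kernel_left_mult:
  assumes i: "i \<in> I" and y: "y \<in> Y" and g: "g \<in> carrier K" and w: "reduced w" "reduced w'"
  shows "tree_kernel (A i g y) (left_mult i g w) (left_mult i g w') = tree_kernel y w w'"
proof -
  obtain a u where a: "a \<in> carrier K" "\<not> starts_with i u" "w = attach i a u"
    using reduced_attach_cases[OF w(1) i] by metis
  obtain b u' where b: "b \<in> carrier K" "\<not> starts_with i u'" "w' = attach i b u'"
    using reduced_attach_cases[OF w(2) i] by metis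
  have A: "A i (inv (g \<otimes> x)) (A i g y) = A i (inv x) y" if "x \<in> carrier K" for x
    using that i y g by (simp add: A_mult[symmetric] inv_mult_group m_assoc)
  have "g \<otimes> a = g \<otimes> b \<longleftrightarrow> a = b" using g a b by simp
  then show ?thesis
    using i y g a b
    by (simp add: left_mult_attach tree_kernel_attach A_closed A \<kappa>_equivariant)
qed

lemma coeff_left_mult:
  assumes "i \<in> I" "y \<in> Y" "g \<in> carrier K" "\<not> starts_with i w"
  shows "coeff (A i g y) (left_mult i g w) = \<kappa> i (A i g y) \<one> g * coeff y w"
  using assms A_mult[of i "inv g" g y]
  by (simp add: left_mult_def coeff_attach A_closed A_one)

subsection \<open>Relabelling the cliques\<close>

definition relabel :: "('i \<Rightarrow> 'i) \<Rightarrow> ('i \<times> 'g) list \<Rightarrow> ('i \<times> 'g) list" where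
  "relabel f = map (map_prod f id)"

lemma relabel_simps [simp]:
  "relabel f [] = []" "relabel f ((i, g) # w) = (f i, g) # relabel f w"
  by (simp_all add: relabel_def)

lemma starts_with_relabel:
  assumes "inj_on f I" "i \<in> I" "reduced w"
  shows "starts_with (f i) (relabel f w) \<longleftrightarrow> starts_with i w"
  using assms by (cases w) (auto dest: inj_onD)

lemma reduced_relabel:
  assumes "inj_on f I" "f ` I \<subseteq> I" "reduced w"
  shows "reduced (relabel f w)"
  using assms(3) by (induction w rule: reduced.induct) (use assms in \<open>auto simp: starts_with_relabel\<close>)

lemma relabel_cong: "reduced w \<Longrightarrow> (\<And>i. i \<in> I \<Longrightarrow> f i = f' i) \<Longrightarrow> relabel f w = relabel f' w"
  by (induction w rule: reduced.induct) auto

lemma relabel_id: "relabel (\<lambda>i. i) w = w"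
  by (induction w) auto

lemma relabel_comp: "relabel f (relabel f' w) = relabel (\<lambda>i. f (f' i)) w"
  by (induction w) auto

lemma left_mult_relabel:
  assumes "inj_on f I" "i \<in> I" "reduced w"
  shows "left_mult (f i) g (relabel f w) = relabel f (left_mult i g w)"
  using assms by (cases w) (auto simp: left_mult_def attach_def dest: inj_onD)

context
  fixes f :: "'i \<Rightarrow> 'i" and \<theta> :: "'y \<Rightarrow> 'y"
  assumes f: "inj_on f I" "f ` I \<subseteq> I" and \<theta>: "\<theta> ` Y \<subseteq> Y"
    and A_f: "\<And>i g y. \<lbrakk>i \<in> I; g \<in> carrier K; y \<in> Y\<rbrakk> \<Longrightarrow> A (f i) g (\<theta> y) = \<theta> (A i g y)"
    and \<kappa>_f: "\<And>i a b y. \<lbrakk>i \<in> I; a \<in> carrier K; b \<in> carrier K; y \<in> Y\<rbrakk>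
                 \<Longrightarrow> \<kappa> (f i) (\<theta> y) a b = \<kappa> i y a b"
begin

lemma coeff_relabel: "reduced w \<Longrightarrow> y \<in> Y \<Longrightarrow> coeff (\<theta> y) (relabel f w) = coeff y w"
  by (induction w arbitrary: y rule: reduced.induct) (use \<theta> in \<open>auto simp: A_f \<kappa>_f A_closed\<close>)

lemma branch_kernel_relabel:
  "reduced w \<Longrightarrow> reduced w' \<Longrightarrow> y \<in> Y
     \<Longrightarrow> branch_kernel (\<theta> y) (relabel f w) (relabel f w') = branch_kernel y w w'"
  by (induction y w w' rule: branch_kernel.induct)
    (use \<theta> f in \<open>auto simp: A_f \<kappa>_f A_closed coeff_relabel dest: inj_onD\<close>)

lemma tree_kernel_relabel:
  "reduced w \<Longrightarrow> reduced w' \<Longrightarrow> y \<in> Y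
     \<Longrightarrow> tree_kernel (\<theta> y) (relabel f w) (relabel f w') = tree_kernel y w w'"
  by (simp add: tree_kernel_def coeff_relabel branch_kernel_relabel)

end

end

section \<open>Geodesic words in graph products\<close>

context group_graph
begin

fun gp_word :: "('a \<times> 'b) list \<Rightarrow> ('a \<times> 'b) list set set" where
  "gp_word [] = \<one>\<^bsub>P\<^esub>"
| "gp_word ((v, g) # ws) = gp_incl V E G v g \<otimes>\<^bsub>P\<^esub> gp_word ws"

lemma gp_incl_closed: "v \<in> V \<Longrightarrow> g \<in> carrier (G v) \<Longrightarrow> gp_incl V E G v g \<in> carrier P"
  using gp_incl_hom by (auto simp: hom_def)

lemma gp_incl_one: "v \<in> V \<Longrightarrow> gp_incl V E G v \<one>\<^bsub>G v\<^esub> = \<one>\<^bsub>P\<^esub>"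
  using hom_one[OF gp_incl_hom grp group_gp] by blast

lemma gp_incl_mult:
  "\<lbrakk>v \<in> V; g \<in> carrier (G v); h \<in> carrier (G v)\<rbrakk>
     \<Longrightarrow> gp_incl V E G v (g \<otimes>\<^bsub>G v\<^esub> h) = gp_incl V E G v g \<otimes>\<^bsub>P\<^esub> gp_incl V E G v h"
  using hom_mult[OF gp_incl_hom] by blast

lemma gp_incl_inv:
  assumes "v \<in> V" "g \<in> carrier (G v)"
  shows "gp_incl V E G v (inv\<^bsub>G v\<^esub> g) = inv\<^bsub>P\<^esub> gp_incl V E G v g"
proof -
  interpret group_hom "G v" P "gp_incl V E G v"
    using assms by (intro group_hom.intro group_hom_axioms.intro grp group_gp gp_incl_hom)
  show ?thesis using assms by simp
qed

lemma gp_incl_commute: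
  assumes vw: "(v, w) \<in> E" "g \<in> carrier (G v)" "h \<in> carrier (G w)"
  shows "gp_incl V E G v g \<otimes>\<^bsub>P\<^esub> gp_incl V E G w h = gp_incl V E G w h \<otimes>\<^bsub>P\<^esub> gp_incl V E G v g"
proof -
  interpret F: group F by (rule group_fp)
  note V = edge_in[OF vw(1)]
  let ?a = "fp_incl V G v g" and ?b = "fp_incl V G w h"
  have a: "?a \<in> carrier F" "?b \<in> carrier F" using V vw by (auto intro: fp_incl_closed)
  have "?a \<otimes>\<^bsub>F\<^esub> ?b \<otimes>\<^bsub>F\<^esub> inv\<^bsub>F\<^esub> ?a \<otimes>\<^bsub>F\<^esub> inv\<^bsub>F\<^esub> ?b \<in> gp_relators V E G"
    using vw unfolding gp_relators_def by blast
  then have "?a \<otimes>\<^bsub>F\<^esub> ?b \<otimes>\<^bsub>F\<^esub> inv\<^bsub>F\<^esub> ?a \<otimes>\<^bsub>F\<^esub> inv\<^bsub>F\<^esub> ?b \<in> N"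
    by (auto simp: normal_closure_def)
  then have "(?a \<otimes>\<^bsub>F\<^esub> ?b \<otimes>\<^bsub>F\<^esub> inv\<^bsub>F\<^esub> ?a \<otimes>\<^bsub>F\<^esub> inv\<^bsub>F\<^esub> ?b) \<otimes>\<^bsub>F\<^esub> (?b \<otimes>\<^bsub>F\<^esub> ?a)
      \<in> N #>\<^bsub>F\<^esub> (?b \<otimes>\<^bsub>F\<^esub> ?a)"
    by (auto simp: r_coset_def)
  also have "(?a \<otimes>\<^bsub>F\<^esub> ?b \<otimes>\<^bsub>F\<^esub> inv\<^bsub>F\<^esub> ?a \<otimes>\<^bsub>F\<^esub> inv\<^bsub>F\<^esub> ?b) \<otimes>\<^bsub>F\<^esub> (?b \<otimes>\<^bsub>F\<^esub> ?a)
      = ?a \<otimes>\<^bsub>F\<^esub> ?b \<otimes>\<^bsub>F\<^esub> (inv\<^bsub>F\<^esub> ?a \<otimes>\<^bsub>F\<^esub> (inv\<^bsub>F\<^esub> ?b \<otimes>\<^bsub>F\<^esub> ?b) \<otimes>\<^bsub>F\<^esub> ?a)"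
    using a by (simp only: F.m_assoc F.m_closed F.inv_closed)
  also have "\<dots> = ?a \<otimes>\<^bsub>F\<^esub> ?b"
    using a by simp
  finally have "N #>\<^bsub>F\<^esub> (?b \<otimes>\<^bsub>F\<^esub> ?a) = N #>\<^bsub>F\<^esub> (?a \<otimes>\<^bsub>F\<^esub> ?b)"
    using a by (intro F.repr_independence normal_imp_subgroup normal_N) auto
  then show ?thesis
    using hom_mult[OF coset_hom a] hom_mult[OF coset_hom a(2,1)] by (simp add: gp_incl_def)
qed

lemma gp_word_closed: "ws \<in> fp_words V G \<Longrightarrow> gp_word ws \<in> carrier P"
proof -
  interpret P: group P by (rule group_gp)
  show "ws \<in> fp_words V G \<Longrightarrow> gp_word ws \<in> carrier P"
    by (induction ws rule: gp_word.induct) (auto simp: gp_incl_closed)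
qed

lemma gp_word_append:
  "us \<in> fp_words V G \<Longrightarrow> ws \<in> fp_words V G \<Longrightarrow> gp_word (us @ ws) = gp_word us \<otimes>\<^bsub>P\<^esub> gp_word ws"
proof -
  interpret P: group P by (rule group_gp)
  show "us \<in> fp_words V G \<Longrightarrow> ws \<in> fp_words V G \<Longrightarrow> gp_word (us @ ws) = gp_word us \<otimes>\<^bsub>P\<^esub> gp_word ws"
    by (induction us rule: gp_word.induct) (auto simp: gp_incl_closed gp_word_closed P.m_assoc)
qed

lemma gp_word_surj: "s \<in> carrier P \<Longrightarrow> \<exists>ws\<in>fp_words V G. gp_word ws = s"
proof (induction rule: gp_induct)
  case one
  show ?case by (rule bexI[of _ "[]"]) simp_all
next
  case (step v g y)
  then obtain ws where "ws \<in> fp_words V G" "gp_word ws = y" by blast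
  then show ?case using step by (intro bexI[of _ "(v, g) # ws"]) auto
qed

definition geodesic :: "('a \<times> 'b) list \<Rightarrow> bool" where
  "geodesic ws \<longleftrightarrow> ws \<in> fp_words V G \<and>
     (\<forall>ws'\<in>fp_words V G. gp_word ws' = gp_word ws \<longrightarrow> length ws \<le> length ws')"

lemma geodesic_words: "geodesic ws \<Longrightarrow> ws \<in> fp_words V G"
  by (simp add: geodesic_def)

lemma geodesic_le:
  "geodesic ws \<Longrightarrow> ws' \<in> fp_words V G \<Longrightarrow> gp_word ws' = gp_word ws \<Longrightarrow> length ws \<le> length ws'"
  by (simp add: geodesic_def)

lemma geodesic_exists:
  assumes "s \<in> carrier P"
  obtains ws where "geodesic ws" "gp_word ws = s"
proof -
  let ?Q = "\<lambda>ws. ws \<in> fp_words V G \<and> gp_word ws = s"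
  obtain ws0 where "?Q ws0" using gp_word_surj[OF assms] by blast
  from ex_has_least_nat[of ?Q, OF this, of length]
  obtain ws where "?Q ws" "\<forall>ws'. ?Q ws' \<longrightarrow> length ws \<le> length ws'" by blast
  then show ?thesis by (intro that[of ws]) (auto simp: geodesic_def)
qed

lemma geodesic_appendD:
  assumes "geodesic (us @ ws)"
  shows "geodesic us" "geodesic ws"
proof -
  have w: "us \<in> fp_words V G" "ws \<in> fp_words V G"
    using geodesic_words[OF assms] by auto
  show "geodesic us" unfolding geodesic_def
  proof (intro conjI ballI impI)
    fix us' assume "us' \<in> fp_words V G" "gp_word us' = gp_word us"
    then show "length us \<le> length us'"
      using geodesic_le[OF assms, of "us' @ ws"] w by (simp add: gp_word_append)
  qed (rule w)
  show "geodesic ws" unfolding geodesic_def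
  proof (intro conjI ballI impI)
    fix ws' assume "ws' \<in> fp_words V G" "gp_word ws' = gp_word ws"
    then show "length ws \<le> length ws'"
      using geodesic_le[OF assms, of "us @ ws'"] w by (simp add: gp_word_append)
  qed (rule w)
qed

lemma geodesic_ConsD: "geodesic (p # ws) \<Longrightarrow> geodesic ws"
  using geodesic_appendD(2)[of "[p]" ws] by simp

lemma geodesic_neq_one:
  assumes "geodesic ((v, g) # ws)"
  shows "g \<noteq> \<one>\<^bsub>G v\<^esub>"
proof
  interpret P: group P by (rule group_gp)
  assume "g = \<one>\<^bsub>G v\<^esub>"
  then have "gp_word ((v, g) # ws) = gp_word ws"
    using geodesic_words[OF assms] by (simp add: gp_incl_one gp_word_closed)
  then show False using geodesic_le[OF assms, of ws] geodesic_words[OF assms] by simp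
qed

lemma geodesic_letters_neq_one: "geodesic ws \<Longrightarrow> (v, g) \<in> set ws \<Longrightarrow> g \<noteq> \<one>\<^bsub>G v\<^esub>"
proof (induction ws)
  case (Cons p ws)
  then show ?case using geodesic_neq_one geodesic_ConsD[of p ws] by (cases "p = (v, g)") auto
qed simp

text \<open>The retraction of the graph product to \<open>G v\<close> fixes the first letter, but kills the second one
  unless its vertex is \<open>v\<close>.\<close>

lemma gp_incl_letter_inj:
  assumes v: "v \<in> V" "g \<in> carrier (G v)" "g \<noteq> \<one>\<^bsub>G v\<^esub>" and w: "w \<in> V" "h \<in> carrier (G w)"
    and eq: "gp_incl V E G v g = gp_incl V E G w h"
  shows "v = w"
proof (rule ccontr)
  assume ne: "v \<noteq> w"
  interpret Gv: group "G v" by (rule grp) fact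
  define \<phi> where "\<phi> u x = (if u = v then x else \<one>\<^bsub>G v\<^esub>)" for u x
  have noloop: "(v, v) \<notin> E" using graph by (auto simp: simplicial_graph_def irrefl_def)
  obtain f where
    "\<And>u x. u \<in> V \<Longrightarrow> x \<in> carrier (G u) \<Longrightarrow> f (gp_incl V E G u x) = \<phi> u x"
  proof (rule gp_universal[of "G v" \<phi>])
    show "\<phi> u \<in> hom (G u) (G v)" if "u \<in> V" for u
      by (auto simp: hom_def \<phi>_def)
    show "\<phi> u x \<otimes>\<^bsub>G v\<^esub> \<phi> u' x' = \<phi> u' x' \<otimes>\<^bsub>G v\<^esub> \<phi> u x"
      if "(u, u') \<in> E" "x \<in> carrier (G u)" "x' \<in> carrier (G u')" for u u' x x'
      using that noloop by (auto simp: \<phi>_def)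
  qed (auto intro: Gv.is_group)
  from this[of v g] this[of w h] show False using v w eq ne by (simp add: \<phi>_def)
qed

definition link :: "'a \<Rightarrow> 'a set" where
  "link v = {w. (v, w) \<in> E}"

lemma link_V: "link v \<subseteq> V"
  using edge_in by (auto simp: link_def)

lemma link_irrefl: "v \<notin> link v"
  using graph by (auto simp: link_def simplicial_graph_def irrefl_def)

lemma fp_words_mono: "S \<subseteq> V \<Longrightarrow> ws \<in> fp_words S G \<Longrightarrow> ws \<in> fp_words V G"
  by (auto simp: fp_words_def)

definition link_subgroup :: "'a \<Rightarrow> ('a \<times> 'b) list set set set" where
  "link_subgroup v = gp_word ` fp_words (link v) G"

lemma link_subgroup_closed: "l \<in> link_subgroup v \<Longrightarrow> l \<in> carrier P"
  by (auto simp: link_subgroup_def intro!: gp_word_closed fp_words_mono[OF link_V])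

lemma subgroup_link: "subgroup (link_subgroup v) P"
proof -
  interpret P: group P by (rule group_gp)
  have mult: "a \<otimes>\<^bsub>P\<^esub> b \<in> link_subgroup v" if ab: "a \<in> link_subgroup v" "b \<in> link_subgroup v" for a b
  proof -
    obtain us ws where *: "us \<in> fp_words (link v) G" "ws \<in> fp_words (link v) G"
      "a = gp_word us" "b = gp_word ws"
      using ab by (auto simp: link_subgroup_def)
    have "a \<otimes>\<^bsub>P\<^esub> b = gp_word (us @ ws)"
      using * fp_words_mono[OF link_V] by (simp add: gp_word_append)
    then show ?thesis using * by (auto simp: link_subgroup_def intro!: imageI)
  qed
  have one: "\<one>\<^bsub>P\<^esub> \<in> link_subgroup v"
    by (auto simp: link_subgroup_def intro!: image_eqI[of _ _ "[]"])
  have "inv\<^bsub>P\<^esub> (gp_word ws) \<in> link_subgroup v" if "ws \<in> fp_words (link v) G" for ws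
    using that
  proof (induction ws rule: gp_word.induct)
    case 1
    then show ?case using one by simp
  next
    case (2 w g ws)
    then have w: "w \<in> V" "g \<in> carrier (G w)" "ws \<in> fp_words V G"
      using fp_words_mono[OF link_V] link_V by auto
    interpret Gw: group "G w" by (rule grp) fact
    have "inv\<^bsub>P\<^esub> gp_incl V E G w g = gp_word [(w, inv\<^bsub>G w\<^esub> g)]"
      using w by (simp add: gp_incl_inv gp_incl_closed)
    moreover have "[(w, inv\<^bsub>G w\<^esub> g)] \<in> fp_words (link v) G" using 2 by simp
    ultimately have "inv\<^bsub>P\<^esub> gp_incl V E G w g \<in> link_subgroup v"
      unfolding link_subgroup_def by (rule image_eqI)
    then show ?case
      using 2 w mult by (simp add: P.inv_mult_group gp_incl_closed gp_word_closed)
  qed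
  then have inv: "inv\<^bsub>P\<^esub> a \<in> link_subgroup v" if "a \<in> link_subgroup v" for a
    using that by (auto simp: link_subgroup_def)
  show ?thesis
    by (rule subgroup.intro) (use link_subgroup_closed one inv mult in auto)
qed

lemma link_subgroup_commute:
  assumes "v \<in> V" "g \<in> carrier (G v)" "l \<in> link_subgroup v"
  shows "gp_incl V E G v g \<otimes>\<^bsub>P\<^esub> l = l \<otimes>\<^bsub>P\<^esub> gp_incl V E G v g"
proof -
  interpret P: group P by (rule group_gp)
  have "gp_incl V E G v g \<otimes>\<^bsub>P\<^esub> gp_word ws = gp_word ws \<otimes>\<^bsub>P\<^esub> gp_incl V E G v g"
    if "ws \<in> fp_words (link v) G" for ws
    using that
  proof (induction ws rule: gp_word.induct)
    case 1
    then show ?case using assms by (simp add: gp_incl_closed)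
  next
    case (2 w h ws)
    then have w: "w \<in> V" "h \<in> carrier (G w)" "ws \<in> fp_words V G" "(v, w) \<in> E"
      using fp_words_mono[OF link_V] edge_in by (auto simp: link_def)
    let ?a = "gp_incl V E G v g" and ?b = "gp_incl V E G w h"
    have c: "?a \<in> carrier P" "?b \<in> carrier P" "gp_word ws \<in> carrier P"
      using w assms by (auto simp: gp_incl_closed gp_word_closed)
    have "?a \<otimes>\<^bsub>P\<^esub> (?b \<otimes>\<^bsub>P\<^esub> gp_word ws) = ?b \<otimes>\<^bsub>P\<^esub> (?a \<otimes>\<^bsub>P\<^esub> gp_word ws)"
      using c gp_incl_commute[OF w(4) assms(2) w(2)] by (simp flip: P.m_assoc)
    then show ?case using 2 c by (simp add: P.m_assoc)
  qed
  then show ?thesis using assms by (auto simp: link_subgroup_def)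
qed

end

section \<open>Actions\<close>

lemma homeo_actionD:
  assumes "homeo_action G X \<alpha>"
  shows homeo_action_closed: "g \<in> carrier G \<Longrightarrow> x \<in> topspace X \<Longrightarrow> \<alpha> g x \<in> topspace X"
    and homeo_action_one: "x \<in> topspace X \<Longrightarrow> \<alpha> \<one>\<^bsub>G\<^esub> x = x"
    and homeo_action_mult: "g \<in> carrier G \<Longrightarrow> h \<in> carrier G \<Longrightarrow> x \<in> topspace X
           \<Longrightarrow> \<alpha> (g \<otimes>\<^bsub>G\<^esub> h) x = \<alpha> g (\<alpha> h x)"
    and homeo_action_continuous: "g \<in> carrier G \<Longrightarrow> continuous_map X X (\<alpha> g)"
    and homeo_action_inv: "g \<in> carrier G \<Longrightarrow> x \<in> topspace X \<Longrightarrow> \<alpha> (inv\<^bsub>G\<^esub> g) (\<alpha> g x) = x"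
    and homeo_action_inv': "g \<in> carrier G \<Longrightarrow> x \<in> topspace X \<Longrightarrow> \<alpha> g (\<alpha> (inv\<^bsub>G\<^esub> g) x) = x"
proof -
  interpret group_action G "topspace X" \<alpha>
    using assms by (simp add: homeo_action_def)
  interpret G: group G using group_hom by (simp add: group_hom_def)
  show closed: "g \<in> carrier G \<Longrightarrow> x \<in> topspace X \<Longrightarrow> \<alpha> g x \<in> topspace X" for g x
    by (rule element_image) auto
  show one: "x \<in> topspace X \<Longrightarrow> \<alpha> \<one>\<^bsub>G\<^esub> x = x" for x
    using id_eq_one by (metis restrict_apply')
  show mult: "g \<in> carrier G \<Longrightarrow> h \<in> carrier G \<Longrightarrow> x \<in> topspace X
           \<Longrightarrow> \<alpha> (g \<otimes>\<^bsub>G\<^esub> h) x = \<alpha> g (\<alpha> h x)" for g h x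
    by (rule composition_rule)
  show "g \<in> carrier G \<Longrightarrow> continuous_map X X (\<alpha> g)"
    using assms by (auto simp: homeo_action_def homeomorphic_imp_continuous_map)
  show "g \<in> carrier G \<Longrightarrow> x \<in> topspace X \<Longrightarrow> \<alpha> (inv\<^bsub>G\<^esub> g) (\<alpha> g x) = x"
    using mult[of "inv\<^bsub>G\<^esub> g" g x] one[of x] by simp
  show "g \<in> carrier G \<Longrightarrow> x \<in> topspace X \<Longrightarrow> \<alpha> g (\<alpha> (inv\<^bsub>G\<^esub> g) x) = x"
    using mult[of g "inv\<^bsub>G\<^esub> g" x] one[of x] by simp
qed

text \<open>Actions on sets are treated as actions on discrete spaces, so that the existence theorem for
  actions of the graph product applies to them.\<close>

lemma homeo_action_discreteI:
  assumes "group G"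
    and closed: "\<And>g w. g \<in> carrier G \<Longrightarrow> w \<in> W \<Longrightarrow> f g w \<in> W"
    and one: "\<And>w. w \<in> W \<Longrightarrow> f \<one>\<^bsub>G\<^esub> w = w"
    and mult: "\<And>g h w. g \<in> carrier G \<Longrightarrow> h \<in> carrier G \<Longrightarrow> w \<in> W \<Longrightarrow> f (g \<otimes>\<^bsub>G\<^esub> h) w = f g (f h w)"
  shows "homeo_action G (discrete_topology W) (\<lambda>g. restrict (f g) W)"
proof -
  interpret G: group G by fact
  have inv: "f (inv\<^bsub>G\<^esub> g) (f g w) = w" "f g (f (inv\<^bsub>G\<^esub> g) w) = w" if "g \<in> carrier G" "w \<in> W" for g w
    using that mult[of "inv\<^bsub>G\<^esub> g" g w] mult[of g "inv\<^bsub>G\<^esub> g" w] one by auto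
  have bij: "bij_betw (restrict (f g) W) W W" if "g \<in> carrier G" for g
    by (rule bij_betw_byWitness[where f' = "f (inv\<^bsub>G\<^esub> g)"]) (use that inv closed in auto)
  then have Bij: "restrict (f g) W \<in> Bij W" if "g \<in> carrier G" for g
    using that by (simp add: Bij_def)
  have "restrict (f (g \<otimes>\<^bsub>G\<^esub> h)) W = compose W (restrict (f g) W) (restrict (f h) W)"
    if "g \<in> carrier G" "h \<in> carrier G" for g h
    using that by (auto simp: compose_def mult closed intro!: restrict_ext)
  then have "(\<lambda>g. restrict (f g) W) \<in> hom G (BijGroup W)"
    by (intro homI) (simp_all add: BijGroup_def Bij)
  then have "group_action G W (\<lambda>g. restrict (f g) W)"
    by (simp add: group_action_def group_hom_def group_hom_axioms_def group_BijGroup G.is_group)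
  moreover have "homeomorphic_map (discrete_topology W) (discrete_topology W) (restrict (f g) W)"
    if "g \<in> carrier G" for g
    using bij[OF that]
    by (intro bijective_open_imp_homeomorphic_map)
      (auto simp: open_map_into_discrete_topology bij_betw_def)
  ultimately show ?thesis by (simp add: homeo_action_def)
qed

lemma (in group_graph) graph_product_action:
  assumes "\<And>v. v \<in> V \<Longrightarrow> homeo_action (G v) X (\<alpha> v)" "commuting_actions E G X \<alpha>"
  shows homeo_graph_product_action: "homeo_action P X (graph_product_action V E G X \<alpha>)"
    and graph_product_action_incl: "v \<in> V \<Longrightarrow> g \<in> carrier (G v)
           \<Longrightarrow> graph_product_action V E G X \<alpha> (gp_incl V E G v g) = \<alpha> v g"
  using theI'[OF graph_product_action_unique[OF assms]]
  by (auto simp: graph_product_action_def)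

text \<open>An element of the groupoid with range \<open>x\<close> is determined by its group component, so positive
  definiteness is a condition on one kernel on the group for each point \<open>x\<close>.\<close>

lemma tg_positive_definite_kernel:
  assumes "group G" and \<alpha>: "homeo_action G X \<alpha>"
  shows "tg_positive_definite G X \<alpha> h \<longleftrightarrow> continuous_map (tg_topology G X) euclidean h \<and>
    (\<forall>x\<in>topspace X. pd_kernel (carrier G) (\<lambda>s t. h (inv\<^bsub>G\<^esub> s \<otimes>\<^bsub>G\<^esub> t, \<alpha> (inv\<^bsub>G\<^esub> t) x)))"
proof -
  interpret G: group G by fact
  let ?k = "\<lambda>x s t. h (inv\<^bsub>G\<^esub> s \<otimes>\<^bsub>G\<^esub> t, \<alpha> (inv\<^bsub>G\<^esub> t) x)"
  have "pd_kernel (carrier G) (?k x) \<longleftrightarrow>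
      (\<forall>n. \<forall>\<eta> :: nat \<Rightarrow> 'a \<times> 'c.
        (\<forall>i<n. \<eta> i \<in> carrier G \<times> topspace X \<and> tg_range \<alpha> (\<eta> i) = x) \<longrightarrow>
        psd_matrix n (\<lambda>i j. h (tg_mult G (tg_inv G \<alpha> (\<eta> i)) (\<eta> j))))" (is "?l = ?r")
    if x: "x \<in> topspace X" for x
  proof
    assume l: ?l
    show ?r
    proof (intro allI impI)
      fix n and \<eta> :: "nat \<Rightarrow> 'a \<times> 'c"
      assume \<eta>: "\<forall>i<n. \<eta> i \<in> carrier G \<times> topspace X \<and> tg_range \<alpha> (\<eta> i) = x"
      have "psd_matrix n (\<lambda>i j. ?k x (fst (\<eta> i)) (fst (\<eta> j)))"
        by (rule pd_kernelD[OF l]) (use \<eta> in auto)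
      then show "psd_matrix n (\<lambda>i j. h (tg_mult G (tg_inv G \<alpha> (\<eta> i)) (\<eta> j)))"
      proof (rule iffD1[OF psd_matrix_cong, rotated])
        fix i j assume "i < n" "j < n"
        obtain s y t z where st: "\<eta> i = (s, y)" "\<eta> j = (t, z)" by (metis surj_pair)
        have "t \<in> carrier G" "z \<in> topspace X" "\<alpha> t z = x"
          using \<eta>[rule_format, OF \<open>j < n\<close>] by (auto simp: st)
        then show "?k x (fst (\<eta> i)) (fst (\<eta> j)) = h (tg_mult G (tg_inv G \<alpha> (\<eta> i)) (\<eta> j))"
          using homeo_action_inv[OF \<alpha>] by (auto simp: st)
      qed
    qed
  next
    assume r: ?r
    show ?l unfolding pd_kernel_def
    proof (intro allI impI)
      fix n and s :: "nat \<Rightarrow> 'a" assume s: "\<forall>i<n. s i \<in> carrier G"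
      let ?\<eta> = "\<lambda>i. (s i, \<alpha> (inv\<^bsub>G\<^esub> (s i)) x)"
      have "\<forall>i<n. ?\<eta> i \<in> carrier G \<times> topspace X \<and> tg_range \<alpha> (?\<eta> i) = x"
        using s x by (simp add: homeo_action_closed[OF \<alpha>] homeo_action_inv'[OF \<alpha>])
      then show "psd_matrix n (\<lambda>i j. ?k x (s i) (s j))"
        using r[rule_format, of n ?\<eta>] by simp
    qed
  qed
  then show ?thesis by (auto simp: tg_positive_definite_def)
qed

section \<open>The factor of a single vertex\<close>

locale gp_action = group_graph V G E
  for V :: "'v set" and G :: "'v \<Rightarrow> ('g, 'm) monoid_scheme" and E :: "'v rel" +
  fixes X :: "'x topology" and \<alpha> :: "'v \<Rightarrow> 'g \<Rightarrow> 'x \<Rightarrow> 'x"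
  assumes act: "\<And>v. v \<in> V \<Longrightarrow> homeo_action (G v) X (\<alpha> v)"
    and comm: "commuting_actions E G X \<alpha>"
begin

abbreviation "\<beta> \<equiv> graph_product_action V E G X \<alpha>"

lemma homeo_\<beta>: "homeo_action P X \<beta>"
  and \<beta>_incl: "\<lbrakk>v \<in> V; g \<in> carrier (G v)\<rbrakk> \<Longrightarrow> \<beta> (gp_incl V E G v g) = \<alpha> v g"
  using homeo_graph_product_action[OF act comm] graph_product_action_incl[OF act comm] by blast+

lemmas \<beta>_closed = homeo_action_closed[OF homeo_\<beta>]
  and \<beta>_one = homeo_action_one[OF homeo_\<beta>]
  and \<beta>_mult = homeo_action_mult[OF homeo_\<beta>]
  and \<beta>_inv = homeo_action_inv[OF homeo_\<beta>]
  and \<beta>_inv' = homeo_action_inv'[OF homeo_\<beta>]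

end

text \<open>The situation at one vertex \<open>v\<close>, with \<open>h\<close> invariant under the groups of the link of \<open>v\<close>.\<close>

locale gp_vertex = gp_action +
  fixes v :: 'a and h :: "'b \<times> 'd \<Rightarrow> complex"
  assumes v: "v \<in> V"
    and h_pd: "tg_positive_definite (G v) X (\<alpha> v) h"
    and h_unital: "tg_unital (G v) X h"
    and h_invariant: "\<lbrakk>(v, w) \<in> E; b \<in> carrier (G w); g \<in> carrier (G v); x \<in> topspace X\<rbrakk>
          \<Longrightarrow> h (g, \<alpha> w b x) = h (g, x)"
begin

sublocale P: group P by (rule group_gp)
sublocale Gv: group "G v" by (rule grp) (rule v)

abbreviation "L \<equiv> link_subgroup v"

lemma h_link_invariant:
  assumes "l \<in> L" "g \<in> carrier (G v)" "x \<in> topspace X"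
  shows "h (g, \<beta> l x) = h (g, x)"
proof -
  have "h (g, \<beta> (gp_word ws) x) = h (g, x)" if "ws \<in> fp_words (link v) G" for ws
    using that
  proof (induction ws rule: gp_word.induct)
    case 1
    then show ?case using assms by (simp add: \<beta>_one)
  next
    case (2 w b ws)
    then have w: "(v, w) \<in> E" "w \<in> V" "b \<in> carrier (G w)" "ws \<in> fp_words V G"
      using fp_words_mono[OF link_V] edge_in by (auto simp: link_def)
    then show ?case
      using 2 assms h_invariant[OF w(1,3) assms(2) \<beta>_closed[OF gp_word_closed[OF w(4)] assms(3)]]
      by (simp add: \<beta>_mult \<beta>_incl gp_incl_closed gp_word_closed)
  qed
  then show ?thesis using assms by (auto simp: link_subgroup_def)
qed

text \<open>The cliques through a point of the tree of cosets of \<open>Q\<close> correspond to the cosets of \<open>L\<close> in \<open>Q\<close>.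
  Admitting all cosets of \<open>L\<close> in the graph product only adds branches that the orbit of the root
  does not meet, and it spares a description of \<open>Q\<close>.\<close>

definition cosets :: "('a \<times> 'b) list set set set set" where
  "cosets = (\<lambda>u. u <#\<^bsub>P\<^esub> L) ` carrier P"

definition rep :: "('a \<times> 'b) list set set set \<Rightarrow> ('a \<times> 'b) list set set" where
  "rep i = (SOME u. u \<in> carrier P \<and> u <#\<^bsub>P\<^esub> L = i)"

text \<open>The clique at a coset \<open>u L\<close> is a copy of \<open>G v\<close> that acts on \<open>X\<close> through the conjugates by \<open>u\<close>, with
  kernel transported by \<open>u\<close>. Neither depends on the choice of \<open>u\<close> (\<open>coset_act_eq\<close>, \<open>coset_kernel_eq\<close>
  below), as \<open>L\<close> commutes with \<open>G v\<close> and leaves \<open>h\<close> invariant.\<close>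

definition coset_act :: "('a \<times> 'b) list set set set \<Rightarrow> 'b \<Rightarrow> 'd \<Rightarrow> 'd" where
  "coset_act i g x = \<beta> (rep i \<otimes>\<^bsub>P\<^esub> gp_incl V E G v g \<otimes>\<^bsub>P\<^esub> inv\<^bsub>P\<^esub> rep i) x"

definition coset_kernel :: "('a \<times> 'b) list set set set \<Rightarrow> 'd \<Rightarrow> 'b \<Rightarrow> 'b \<Rightarrow> complex" where
  "coset_kernel i x a b =
     h (inv\<^bsub>G v\<^esub> a \<otimes>\<^bsub>G v\<^esub> b, \<alpha> v (inv\<^bsub>G v\<^esub> b) (\<beta> (inv\<^bsub>P\<^esub> rep i) x))"

lemma rep:
  assumes "i \<in> cosets"
  shows "rep i \<in> carrier P" "rep i <#\<^bsub>P\<^esub> L = i"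
proof -
  have "\<exists>u. u \<in> carrier P \<and> u <#\<^bsub>P\<^esub> L = i" using assms by (auto simp: cosets_def)
  from someI_ex[OF this] show "rep i \<in> carrier P" "rep i <#\<^bsub>P\<^esub> L = i" by (auto simp: rep_def)
qed

lemma incl: "g \<in> carrier (G v) \<Longrightarrow> gp_incl V E G v g \<in> carrier P"
  by (rule gp_incl_closed[OF v])

lemma coset_kernel_pd: "i \<in> cosets \<Longrightarrow> x \<in> topspace X \<Longrightarrow> pd_kernel (carrier (G v)) (coset_kernel i x)"
  using h_pd unfolding tg_positive_definite_kernel[OF Gv.is_group act[OF v]]
  by (auto simp: coset_kernel_def[abs_def] rep \<beta>_closed)

lemma coset_kernel_equivariant:
  assumes i: "i \<in> cosets" and x: "x \<in> topspace X"
    and g: "g \<in> carrier (G v)" "a \<in> carrier (G v)" "b \<in> carrier (G v)"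
  shows "coset_kernel i (coset_act i g x) (g \<otimes>\<^bsub>G v\<^esub> a) (g \<otimes>\<^bsub>G v\<^esub> b) = coset_kernel i x a b"
proof -
  let ?u = "rep i" and ?g = "gp_incl V E G v g"
  have c: "?u \<in> carrier P" "?g \<in> carrier P" using i g by (auto simp: rep incl)
  have y: "\<beta> (inv\<^bsub>P\<^esub> ?u) x \<in> topspace X" using c x by (simp add: \<beta>_closed)
  have "\<beta> (inv\<^bsub>P\<^esub> ?u) (coset_act i g x) = \<beta> ?g (\<beta> (inv\<^bsub>P\<^esub> ?u) x)"
    using c x by (simp add: coset_act_def \<beta>_mult \<beta>_closed \<beta>_inv)
  also have "\<dots> = \<alpha> v g (\<beta> (inv\<^bsub>P\<^esub> ?u) x)" using g by (simp add: \<beta>_incl v)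
  finally have 1: "\<beta> (inv\<^bsub>P\<^esub> ?u) (coset_act i g x) = \<alpha> v g (\<beta> (inv\<^bsub>P\<^esub> ?u) x)" .
  have 2: "\<alpha> v (inv\<^bsub>G v\<^esub> (g \<otimes>\<^bsub>G v\<^esub> b)) (\<alpha> v g z) = \<alpha> v (inv\<^bsub>G v\<^esub> b) z" if "z \<in> topspace X" for z
    using that g homeo_action_mult[OF act[OF v]] homeo_action_inv[OF act[OF v]]
      homeo_action_closed[OF act[OF v]] by (simp add: Gv.inv_mult_group)
  have 3: "inv\<^bsub>G v\<^esub> (g \<otimes>\<^bsub>G v\<^esub> a) \<otimes>\<^bsub>G v\<^esub> (g \<otimes>\<^bsub>G v\<^esub> b) = inv\<^bsub>G v\<^esub> a \<otimes>\<^bsub>G v\<^esub> b"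
    using g by (simp add: Gv.inv_mult_group Gv.m_assoc Gv.inv_solve_left')
  show ?thesis by (simp add: coset_kernel_def 1 2[OF y] 3)
qed

sublocale T: clique_tree "G v" cosets "topspace X" coset_act coset_kernel
proof unfold_locales
  fix i x assume i: "i \<in> cosets" and x: "x \<in> topspace X"
  note r = rep(1)[OF i]
  show "pd_kernel (carrier (G v)) (coset_kernel i x)" by (rule coset_kernel_pd[OF i x])
  have "\<beta> (inv\<^bsub>P\<^esub> rep i) x \<in> topspace X" using r x by (simp add: \<beta>_closed)
  then show "coset_kernel i x \<one>\<^bsub>G v\<^esub> \<one>\<^bsub>G v\<^esub> = 1"
    using h_unital by (simp add: coset_kernel_def homeo_action_one[OF act[OF v]] tg_unital_def)
  show "coset_act i \<one>\<^bsub>G v\<^esub> x = x"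
    using r x by (simp add: coset_act_def gp_incl_one v \<beta>_one)
  fix g assume g: "g \<in> carrier (G v)"
  show "coset_act i g x \<in> topspace X" using r x g by (simp add: coset_act_def \<beta>_closed incl)
  fix g' assume g': "g' \<in> carrier (G v)"
  show "coset_act i (g \<otimes>\<^bsub>G v\<^esub> g') x = coset_act i g (coset_act i g' x)"
    using r x g g' by (simp add: coset_act_def gp_incl_mult v \<beta>_closed incl \<beta>_mult \<beta>_inv)
  show "coset_kernel i (coset_act i g' x) (g' \<otimes>\<^bsub>G v\<^esub> a) (g' \<otimes>\<^bsub>G v\<^esub> g) = coset_kernel i x a g"
    if "a \<in> carrier (G v)" for a
    using coset_kernel_equivariant[OF i x g' that g] .
qed

lemma L_closed: "L \<subseteq> carrier P"
  using link_subgroup_closed by auto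

lemma coset_mult:
  assumes "i \<in> cosets" "b \<in> carrier P"
  shows "b <#\<^bsub>P\<^esub> i \<in> cosets"
proof -
  obtain u where "u \<in> carrier P" "i = u <#\<^bsub>P\<^esub> L" using assms by (auto simp: cosets_def)
  then show ?thesis using assms by (auto simp: cosets_def P.lcos_m_assoc[OF L_closed])
qed

lemma coset_subset: "i \<in> cosets \<Longrightarrow> i \<subseteq> carrier P"
  using P.l_coset_subset_G[OF L_closed] by (auto simp: cosets_def)

lemma coset_inj: "b \<in> carrier P \<Longrightarrow> inj_on ((<#\<^bsub>P\<^esub>) b) cosets"
proof (rule inj_onI)
  fix i j assume b: "b \<in> carrier P" and ij: "i \<in> cosets" "j \<in> cosets" "b <#\<^bsub>P\<^esub> i = b <#\<^bsub>P\<^esub> j"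
  have "inv\<^bsub>P\<^esub> b <#\<^bsub>P\<^esub> (b <#\<^bsub>P\<^esub> k) = k" if "k \<in> cosets" for k
    using b that by (simp add: P.lcos_m_assoc coset_subset P.lcos_mult_one)
  then show "i = j" using ij by metis
qed

lemma rep_eqD:
  assumes "u \<in> carrier P" "i = u <#\<^bsub>P\<^esub> L"
  obtains l where "l \<in> L" "rep i = u \<otimes>\<^bsub>P\<^esub> l"
proof -
  have i: "i \<in> cosets" using assms by (auto simp: cosets_def)
  have "rep i \<in> rep i <#\<^bsub>P\<^esub> L"
    using subgroup.one_closed[OF subgroup_link] rep(1)[OF i] by (force simp: l_coset_def)
  then have "rep i \<in> u <#\<^bsub>P\<^esub> L" using rep(2)[OF i] assms(2) by simp
  then show ?thesis using that unfolding l_coset_def by blast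
qed

lemma coset_act_eq:
  assumes u: "u \<in> carrier P" and g: "g \<in> carrier (G v)"
  shows "coset_act (u <#\<^bsub>P\<^esub> L) g x = \<beta> (u \<otimes>\<^bsub>P\<^esub> gp_incl V E G v g \<otimes>\<^bsub>P\<^esub> inv\<^bsub>P\<^esub> u) x"
proof -
  obtain l where l: "l \<in> L" "rep (u <#\<^bsub>P\<^esub> L) = u \<otimes>\<^bsub>P\<^esub> l" using rep_eqD[OF u HOL.refl] .
  have lc: "l \<in> carrier P" using l L_closed by blast
  have "u \<otimes>\<^bsub>P\<^esub> l \<otimes>\<^bsub>P\<^esub> gp_incl V E G v g \<otimes>\<^bsub>P\<^esub> inv\<^bsub>P\<^esub> (u \<otimes>\<^bsub>P\<^esub> l)
      = u \<otimes>\<^bsub>P\<^esub> (l \<otimes>\<^bsub>P\<^esub> gp_incl V E G v g) \<otimes>\<^bsub>P\<^esub> inv\<^bsub>P\<^esub> l \<otimes>\<^bsub>P\<^esub> inv\<^bsub>P\<^esub> u"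
    using u lc g by (simp add: P.inv_mult_group P.m_assoc incl)
  also have "\<dots> = u \<otimes>\<^bsub>P\<^esub> gp_incl V E G v g \<otimes>\<^bsub>P\<^esub> inv\<^bsub>P\<^esub> u"
    using u lc g by (simp add: P.m_assoc incl link_subgroup_commute[OF v g l(1), symmetric])
  finally show ?thesis by (simp add: coset_act_def l)
qed

lemma coset_kernel_eq:
  assumes u: "u \<in> carrier P" and ab: "a \<in> carrier (G v)" "b \<in> carrier (G v)" and x: "x \<in> topspace X"
  shows "coset_kernel (u <#\<^bsub>P\<^esub> L) x a b
    = h (inv\<^bsub>G v\<^esub> a \<otimes>\<^bsub>G v\<^esub> b, \<alpha> v (inv\<^bsub>G v\<^esub> b) (\<beta> (inv\<^bsub>P\<^esub> u) x))"
proof -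
  obtain l where l: "l \<in> L" "rep (u <#\<^bsub>P\<^esub> L) = u \<otimes>\<^bsub>P\<^esub> l" using rep_eqD[OF u HOL.refl] .
  have lc: "l \<in> carrier P" using l L_closed by blast
  have li: "inv\<^bsub>P\<^esub> l \<in> L" using l subgroup.m_inv_closed[OF subgroup_link] by blast
  define z where "z = \<beta> (inv\<^bsub>P\<^esub> u) x"
  have z: "z \<in> topspace X" using u x by (simp add: z_def \<beta>_closed)
  have bi: "inv\<^bsub>G v\<^esub> b \<in> carrier (G v)" using ab by simp
  have "\<beta> (inv\<^bsub>P\<^esub> (u \<otimes>\<^bsub>P\<^esub> l)) x = \<beta> (inv\<^bsub>P\<^esub> l) z"
    using u lc x by (simp add: P.inv_mult_group \<beta>_mult z_def)
  moreover have "\<alpha> v (inv\<^bsub>G v\<^esub> b) (\<beta> (inv\<^bsub>P\<^esub> l) z) = \<beta> (inv\<^bsub>P\<^esub> l) (\<alpha> v (inv\<^bsub>G v\<^esub> b) z)"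
    using lc z bi link_subgroup_commute[OF v bi li]
    by (simp add: \<beta>_incl[OF v bi, symmetric] \<beta>_mult[symmetric] incl)
  moreover have "h (inv\<^bsub>G v\<^esub> a \<otimes>\<^bsub>G v\<^esub> b, \<beta> (inv\<^bsub>P\<^esub> l) (\<alpha> v (inv\<^bsub>G v\<^esub> b) z))
      = h (inv\<^bsub>G v\<^esub> a \<otimes>\<^bsub>G v\<^esub> b, \<alpha> v (inv\<^bsub>G v\<^esub> b) z)"
    using ab z by (intro h_link_invariant[OF li]) (simp_all add: homeo_action_closed[OF act[OF v]])
  ultimately show ?thesis by (simp add: coset_kernel_def l z_def)
qed

lemma coset_act_shift:
  assumes "i \<in> cosets" "g \<in> carrier (G v)" "b \<in> carrier P" "x \<in> topspace X"
  shows "coset_act (b <#\<^bsub>P\<^esub> i) g (\<beta> b x) = \<beta> b (coset_act i g x)"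
proof -
  obtain u where u: "u \<in> carrier P" "i = u <#\<^bsub>P\<^esub> L" using assms by (auto simp: cosets_def)
  then have "b <#\<^bsub>P\<^esub> i = (b \<otimes>\<^bsub>P\<^esub> u) <#\<^bsub>P\<^esub> L" using assms by (simp add: P.lcos_m_assoc[OF L_closed])
  then show ?thesis
    using u assms by (simp add: coset_act_eq P.inv_mult_group \<beta>_mult incl \<beta>_inv \<beta>_closed)
qed

lemma coset_kernel_shift:
  assumes "i \<in> cosets" "a \<in> carrier (G v)" "c \<in> carrier (G v)" "b \<in> carrier P" "x \<in> topspace X"
  shows "coset_kernel (b <#\<^bsub>P\<^esub> i) (\<beta> b x) a c = coset_kernel i x a c"
proof -
  obtain u where u: "u \<in> carrier P" "i = u <#\<^bsub>P\<^esub> L" using assms by (auto simp: cosets_def)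
  then have "b <#\<^bsub>P\<^esub> i = (b \<otimes>\<^bsub>P\<^esub> u) <#\<^bsub>P\<^esub> L" using assms by (simp add: P.lcos_m_assoc[OF L_closed])
  then show ?thesis
    using u assms by (simp add: coset_kernel_eq P.inv_mult_group \<beta>_mult \<beta>_inv \<beta>_closed)
qed

lemma L_coset: "L \<in> cosets"
  using P.lcos_mult_one[OF L_closed] by (force simp: cosets_def)

lemma link_fixes_L: "(v, w) \<in> E \<Longrightarrow> b \<in> carrier (G w) \<Longrightarrow> gp_incl V E G w b <#\<^bsub>P\<^esub> L = L"
proof -
  assume w: "(v, w) \<in> E" "b \<in> carrier (G w)"
  then have wV: "w \<in> V" using edge_in by blast
  have "gp_word [(w, b)] \<in> L" unfolding link_subgroup_def
    by (rule imageI) (use w in \<open>simp add: link_def\<close>)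
  then have "gp_incl V E G w b \<in> \<one>\<^bsub>P\<^esub> <#\<^bsub>P\<^esub> L"
    using w wV by (simp add: gp_incl_closed P.lcos_mult_one L_closed)
  from P.l_repr_independence[OF this P.one_closed subgroup_link]
  show ?thesis by (simp add: P.lcos_mult_one L_closed)
qed

text \<open>\<open>G v\<close> moves the root inside the clique \<open>L\<close>; the other vertex groups fix the root and permute the
  cliques through it. The two kinds of maps commute for the vertices in the link of \<open>v\<close>, since their
  groups fix the coset \<open>L\<close> (\<open>vertex_act_link\<close>), so the graph product acts on the tree.\<close>

definition vertex_act where
  "vertex_act w b = (if w = v then T.left_mult L b else T.relabel ((<#\<^bsub>P\<^esub>) (gp_incl V E G w b)))"

abbreviation "W \<equiv> Collect T.reduced"

definition tree_action where
  "tree_action = graph_product_action V E G (discrete_topology W) (\<lambda>w b. restrict (vertex_act w b) W)"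

lemma reduced_vertex_act:
  assumes "w \<in> V" "b \<in> carrier (G w)" "T.reduced t"
  shows "T.reduced (vertex_act w b t)"
proof (cases "w = v")
  case False
  have "T.reduced (T.relabel ((<#\<^bsub>P\<^esub>) (gp_incl V E G w b)) t)"
    using assms by (intro T.reduced_relabel coset_inj) (auto simp: gp_incl_closed coset_mult)
  then show ?thesis using False by (simp add: vertex_act_def)
qed (use assms in \<open>auto simp: vertex_act_def T.reduced_left_mult L_coset\<close>)

lemma homeo_vertex_act:
  assumes "w \<in> V"
  shows "homeo_action (G w) (discrete_topology W) (\<lambda>b. restrict (vertex_act w b) W)"
proof (rule homeo_action_discreteI)
  interpret Gw: group "G w" by (rule grp) fact
  show "group (G w)" by (rule Gw.is_group)
  show "vertex_act w b t \<in> W" if "b \<in> carrier (G w)" "t \<in> W" for b t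
    using that reduced_vertex_act[OF assms] by simp
  show "vertex_act w \<one>\<^bsub>G w\<^esub> t = t" if "t \<in> W" for t
  proof (cases "w = v")
    case False
    have "T.relabel ((<#\<^bsub>P\<^esub>) (gp_incl V E G w \<one>\<^bsub>G w\<^esub>)) t = T.relabel (\<lambda>i. i) t"
      using that by (intro T.relabel_cong) (auto simp: gp_incl_one assms P.lcos_mult_one coset_subset)
    then show ?thesis using False by (simp add: vertex_act_def T.relabel_id)
  qed (use that in \<open>auto simp: vertex_act_def T.left_mult_one L_coset\<close>)
  show "vertex_act w (b \<otimes>\<^bsub>G w\<^esub> b') t = vertex_act w b (vertex_act w b' t)"
    if "b \<in> carrier (G w)" "b' \<in> carrier (G w)" "t \<in> W" for b b' t
  proof (cases "w = v")
    case False
    have "T.relabel ((<#\<^bsub>P\<^esub>) (gp_incl V E G w (b \<otimes>\<^bsub>G w\<^esub> b'))) t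
        = T.relabel (\<lambda>i. gp_incl V E G w b <#\<^bsub>P\<^esub> (gp_incl V E G w b' <#\<^bsub>P\<^esub> i)) t"
      using that assms
      by (intro T.relabel_cong) (auto simp: gp_incl_mult P.lcos_m_assoc coset_subset gp_incl_closed)
    then show ?thesis using False by (simp add: vertex_act_def T.relabel_comp)
  qed (use that in \<open>auto simp: vertex_act_def T.left_mult_mult L_coset\<close>)
qed

lemma vertex_act_link:
  assumes "(v, w) \<in> E" "g \<in> carrier (G v)" "b \<in> carrier (G w)" "T.reduced t"
  shows "vertex_act v g (vertex_act w b t) = vertex_act w b (vertex_act v g t)"
proof -
  have w: "w \<in> V" "w \<noteq> v" using assms(1) edge_in link_irrefl by (auto simp: link_def)
  have "T.left_mult ((<#\<^bsub>P\<^esub>) (gp_incl V E G w b) L) g (T.relabel ((<#\<^bsub>P\<^esub>) (gp_incl V E G w b)) t)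
      = T.relabel ((<#\<^bsub>P\<^esub>) (gp_incl V E G w b)) (T.left_mult L g t)"
    using w assms by (intro T.left_mult_relabel coset_inj L_coset gp_incl_closed)
  then show ?thesis using w link_fixes_L[OF assms(1,3)] by (simp add: vertex_act_def)
qed

lemma vertex_acts_commute:
  "commuting_actions E G (discrete_topology W) (\<lambda>w b. restrict (vertex_act w b) W)"
proof -
  have "vertex_act u a (vertex_act w b t) = vertex_act w b (vertex_act u a t)"
    if uw: "(u, w) \<in> E" and ab: "a \<in> carrier (G u)" "b \<in> carrier (G w)" and t: "T.reduced t" for u w a b t
  proof -
    have wu: "(w, u) \<in> E" "u \<in> V" "w \<in> V"
      using uw edge_in graph by (auto simp: simplicial_graph_def sym_def)
    consider "u = v" | "w = v" | "u \<noteq> v" "w \<noteq> v" by blast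
    then show ?thesis
    proof cases
      case 1
      then show ?thesis using vertex_act_link uw ab t by blast
    next
      case 2
      then show ?thesis using vertex_act_link[of u b a t] wu ab t by simp
    next
      case 3
      let ?a = "gp_incl V E G u a" and ?b = "gp_incl V E G w b"
      have "?a <#\<^bsub>P\<^esub> (?b <#\<^bsub>P\<^esub> i) = ?b <#\<^bsub>P\<^esub> (?a <#\<^bsub>P\<^esub> i)" if "i \<in> cosets" for i
        using that wu ab gp_incl_commute[OF uw ab]
        by (simp add: P.lcos_m_assoc coset_subset gp_incl_closed)
      then show ?thesis
        using 3 t by (simp add: vertex_act_def T.relabel_comp cong: T.relabel_cong)
    qed
  qed
  then show ?thesis
    using edge_in reduced_vertex_act by (fastforce simp: commuting_actions_def)
qed

lemma homeo_tree_action: "homeo_action P (discrete_topology W) tree_action"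
  unfolding tree_action_def by (rule homeo_graph_product_action[OF homeo_vertex_act vertex_acts_commute])

lemma tree_action_incl:
  "w \<in> V \<Longrightarrow> b \<in> carrier (G w) \<Longrightarrow> T.reduced t \<Longrightarrow> tree_action (gp_incl V E G w b) t = vertex_act w b t"
  unfolding tree_action_def
  using graph_product_action_incl[OF homeo_vertex_act vertex_acts_commute] by simp

lemma tree_action_one: "T.reduced t \<Longrightarrow> tree_action \<one>\<^bsub>P\<^esub> t = t"
  using homeo_action_one[OF homeo_tree_action] by simp

lemma tree_action_step:
  assumes "w \<in> V" "b \<in> carrier (G w)" "s \<in> carrier P" "T.reduced t"
  shows "tree_action (gp_incl V E G w b \<otimes>\<^bsub>P\<^esub> s) t = vertex_act w b (tree_action s t)"
proof -
  have "tree_action s t \<in> W" using homeo_action_closed[OF homeo_tree_action, of s t] assms by simp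
  then show ?thesis
    using assms homeo_action_mult[OF homeo_tree_action, of "gp_incl V E G w b" s t]
    by (simp add: gp_incl_closed tree_action_incl)
qed

lemma reduced_tree_action: "s \<in> carrier P \<Longrightarrow> T.reduced t \<Longrightarrow> T.reduced (tree_action s t)"
  using homeo_action_closed[OF homeo_tree_action, of s t] by simp

lemma coset_act_L: "g \<in> carrier (G v) \<Longrightarrow> x \<in> topspace X \<Longrightarrow> coset_act L g x = \<alpha> v g x"
  using coset_act_eq[of "\<one>\<^bsub>P\<^esub>" g x] by (simp add: P.lcos_mult_one L_closed incl \<beta>_incl v)

lemma coset_kernel_L:
  "g \<in> carrier (G v) \<Longrightarrow> x \<in> topspace X \<Longrightarrow> coset_kernel L (\<alpha> v g x) \<one>\<^bsub>G v\<^esub> g = h (g, x)"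
  using coset_kernel_eq[of "\<one>\<^bsub>P\<^esub>" "\<one>\<^bsub>G v\<^esub>" g "\<alpha> v g x"]
  by (simp add: P.lcos_mult_one L_closed homeo_action_closed[OF act[OF v]] \<beta>_one
      homeo_action_inv[OF act[OF v]])

text \<open>It suffices to consider generators. For those from \<open>G v\<close> this is the equivariance of the tree
  kernel under left multiplication, for the others it is compatibility with the relabelling of the
  cliques.\<close>

lemma tree_kernel_equivariant:
  assumes "s \<in> carrier P" "T.reduced t" "T.reduced t'" "x \<in> topspace X"
  shows "T.tree_kernel (\<beta> s x) (tree_action s t) (tree_action s t') = T.tree_kernel x t t'"
  using assms(1)
proof (induction rule: gp_induct)
  case one
  then show ?case
    using assms by (simp add: \<beta>_one tree_action_one)
next
  case (step w b s)
  let ?b = "gp_incl V E G w b"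
  have y: "\<beta> s x \<in> topspace X" "T.reduced (tree_action s t)" "T.reduced (tree_action s t')"
    using assms step by (auto simp: \<beta>_closed reduced_tree_action)
  have eq: "\<beta> (?b \<otimes>\<^bsub>P\<^esub> s) x = \<alpha> w b (\<beta> s x)"
    using step assms by (simp add: \<beta>_mult \<beta>_incl gp_incl_closed)
  have "T.tree_kernel (\<alpha> w b (\<beta> s x)) (vertex_act w b (tree_action s t)) (vertex_act w b (tree_action s t'))
      = T.tree_kernel (\<beta> s x) (tree_action s t) (tree_action s t')"
  proof (cases "w = v")
    case True
    then show ?thesis
      using T.tree_kernel_left_mult[OF L_coset y(1) _ y(2,3), of b] step y
      by (simp add: vertex_act_def coset_act_L)
  next
    case False
    have bP: "?b \<in> carrier P" using step by (simp add: gp_incl_closed)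
    have "T.tree_kernel (\<beta> ?b (\<beta> s x)) (T.relabel ((<#\<^bsub>P\<^esub>) ?b) (tree_action s t))
            (T.relabel ((<#\<^bsub>P\<^esub>) ?b) (tree_action s t'))
        = T.tree_kernel (\<beta> s x) (tree_action s t) (tree_action s t')"
      by (rule T.tree_kernel_relabel)
        (use bP y in \<open>auto simp: coset_inj coset_mult coset_act_shift coset_kernel_shift \<beta>_closed\<close>)
    then show ?thesis using False step by (simp add: vertex_act_def \<beta>_incl)
  qed
  then show ?case using step assms by (simp add: eq tree_action_step)
qed

text \<open>The value of the tree kernel, with parameter \<open>s x\<close>, between the root and its translate by \<open>s\<close>.\<close>

definition vertex_factor :: "('a \<times> 'b) list set set \<Rightarrow> 'd \<Rightarrow> complex" where
  "vertex_factor s x = T.coeff (\<beta> s x) (tree_action s [])"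

text \<open>By equivariance, the kernel of the vertex factor at \<open>x\<close> is the pullback of the tree kernel with
  parameter \<open>x\<close> along the orbit map of the root.\<close>

lemma vertex_factor_pd:
  assumes x: "x \<in> topspace X"
  shows "pd_kernel (carrier P) (\<lambda>s t. vertex_factor (inv\<^bsub>P\<^esub> s \<otimes>\<^bsub>P\<^esub> t) (\<beta> (inv\<^bsub>P\<^esub> t) x))"
proof -
  have "pd_kernel (carrier P) (\<lambda>s t. T.tree_kernel x (tree_action s []) (tree_action t []))"
    by (rule pd_kernel_pullback[OF T.pd_tree_kernel[OF x]])
      (simp add: T.reduced_lists reduced_tree_action)
  then show ?thesis
  proof (rule iffD1[OF pd_kernel_cong, rotated])
    fix s t assume st: "s \<in> carrier P" "t \<in> carrier P"
    let ?s = "inv\<^bsub>P\<^esub> s"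
    have "vertex_factor (?s \<otimes>\<^bsub>P\<^esub> t) (\<beta> (inv\<^bsub>P\<^esub> t) x)
        = T.tree_kernel (\<beta> ?s x) [] (tree_action ?s (tree_action t []))"
      using st x homeo_action_mult[OF homeo_tree_action, of ?s t "[]"]
      by (simp add: vertex_factor_def T.tree_kernel_root \<beta>_mult \<beta>_closed \<beta>_inv')
    also have "\<dots> = T.tree_kernel (\<beta> ?s x) (tree_action ?s (tree_action s [])) (tree_action ?s (tree_action t []))"
      using st homeo_action_inv[OF homeo_tree_action, of s "[]"] by simp
    also have "\<dots> = T.tree_kernel x (tree_action s []) (tree_action t [])"
      using st x by (intro tree_kernel_equivariant) (auto simp: reduced_tree_action)
    finally show "T.tree_kernel x (tree_action s []) (tree_action t [])
        = vertex_factor (?s \<otimes>\<^bsub>P\<^esub> t) (\<beta> (inv\<^bsub>P\<^esub> t) x)" by (rule HOL.sym)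
  qed
qed

lemma vertex_factor_one: "x \<in> topspace X \<Longrightarrow> vertex_factor \<one>\<^bsub>P\<^esub> x = 1"
  by (simp add: vertex_factor_def tree_action_one)

text \<open>Otherwise \<open>us\<close> represents an element of \<open>L\<close>, which commutes with \<open>g\<close>, and merging \<open>g\<close> with \<open>g'\<close> would
  shorten the word.\<close>

lemma geodesic_not_starts_with:
  assumes geo: "geodesic ((v, g) # us @ (v, g') # ws)"
  shows "gp_word us <#\<^bsub>P\<^esub> L \<noteq> L"
proof
  have w: "us \<in> fp_words V G" "ws \<in> fp_words V G" "g \<in> carrier (G v)" "g' \<in> carrier (G v)"
    using geodesic_words[OF geo] by auto
  assume "gp_word us <#\<^bsub>P\<^esub> L = L"
  moreover have "gp_word us \<in> gp_word us <#\<^bsub>P\<^esub> L"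
    using subgroup.one_closed[OF subgroup_link] gp_word_closed[OF w(1)] by (force simp: l_coset_def)
  ultimately have L: "gp_word us \<in> L" by simp
  let ?g = "gp_incl V E G v g" and ?g' = "gp_incl V E G v g'"
  have c: "?g \<in> carrier P" "?g' \<in> carrier P" "gp_word us \<in> carrier P" "gp_word ws \<in> carrier P"
    using w by (auto simp: incl gp_word_closed)
  have "gp_word (us @ (v, g \<otimes>\<^bsub>G v\<^esub> g') # ws) = gp_word us \<otimes>\<^bsub>P\<^esub> ?g \<otimes>\<^bsub>P\<^esub> (?g' \<otimes>\<^bsub>P\<^esub> gp_word ws)"
    using w c v by (simp add: gp_word_append gp_incl_mult P.m_assoc)
  also have "\<dots> = gp_word ((v, g) # us @ (v, g') # ws)"
    using w c v by (simp add: gp_word_append link_subgroup_commute[OF v w(3) L, symmetric] P.m_assoc)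
  finally have "length ((v, g) # us @ (v, g') # ws) \<le> length (us @ (v, g \<otimes>\<^bsub>G v\<^esub> g') # ws)"
    using w v by (intro geodesic_le[OF geo]) auto
  then show False by simp
qed

text \<open>A shortest word displays the first clique on the path from the root to its translate: an initial
  part of the word, followed by a letter of vertex \<open>v\<close>, represents it. No letter of vertex \<open>v\<close> is
  absorbed on the way, by \<open>geodesic_not_starts_with\<close>.\<close>

lemma tree_action_geodesic_head:
  "geodesic ws \<Longrightarrow> tree_action (gp_word ws) [] = (i, g) # t
     \<Longrightarrow> \<exists>us ws'. ws = us @ (v, g) # ws' \<and> gp_word us <#\<^bsub>P\<^esub> L = i"
proof (induction ws arbitrary: i g t)
  case Nil
  then show ?case by (simp add: tree_action_one)
next
  case (Cons p ws)
  obtain w b where p: "p = (w, b)" by (cases p)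
  have wb: "w \<in> V" "b \<in> carrier (G w)" "ws \<in> fp_words V G"
    using geodesic_words[OF Cons.prems(1)] by (auto simp: p)
  note geo = geodesic_ConsD[OF Cons.prems(1)]
  define s where "s = tree_action (gp_word ws) []"
  have s: "T.reduced s" unfolding s_def using wb by (simp add: reduced_tree_action gp_word_closed)
  have step: "vertex_act w b s = (i, g) # t"
    using Cons.prems(2) wb by (simp add: p tree_action_step gp_word_closed s_def)
  show ?case
  proof (cases "w = v")
    case False
    then have "T.relabel ((<#\<^bsub>P\<^esub>) (gp_incl V E G w b)) s = (i, g) # t"
      using step by (simp add: vertex_act_def)
    then obtain j t' where j: "s = (j, g) # t'" "i = gp_incl V E G w b <#\<^bsub>P\<^esub> j"
      by (cases s) (auto simp: T.relabel_def)
    obtain us ws' where us: "ws = us @ (v, g) # ws'" "gp_word us <#\<^bsub>P\<^esub> L = j"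
      using Cons.IH[OF geo] j by (auto simp: s_def)
    have "us \<in> fp_words V G" using us(1) wb(3) by simp
    then have "gp_word (p # us) <#\<^bsub>P\<^esub> L = i"
      using wb us j by (simp add: p P.lcos_m_assoc[OF L_closed, symmetric] gp_incl_closed gp_word_closed)
    moreover have "p # ws = (p # us) @ (v, g) # ws'" using us by simp
    ultimately show ?thesis by blast
  next
    case True
    have "\<not> T.starts_with L s"
    proof
      assume "T.starts_with L s"
      then obtain g' t' where "s = (L, g') # t'" by (cases s) auto
      then obtain us ws' where "ws = us @ (v, g') # ws'" "gp_word us <#\<^bsub>P\<^esub> L = L"
        using Cons.IH[OF geo, of L g' t'] unfolding s_def by blast
      then show False
        using geodesic_not_starts_with[of b us g' ws'] Cons.prems(1) by (simp add: p True)
    qed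
    then have "T.attach L b s = (i, g) # t"
      using step by (simp add: True vertex_act_def T.left_mult_def)
    moreover have "b \<noteq> \<one>\<^bsub>G v\<^esub>"
      using geodesic_neq_one Cons.prems(1) by (simp add: p True)
    ultimately have "i = L" "b = g" by (auto simp: T.attach_def)
    then show ?thesis
      by (intro exI[of _ "[]"] exI[of _ ws]) (simp add: p True P.lcos_mult_one L_closed)
  qed
qed

text \<open>Along a shortest word, letters of vertex \<open>v\<close> are never absorbed, because the
  path to the translate of the root by the remaining word does not start in the clique \<open>L\<close>; letters of other vertices only relabel cliques.\<close>

lemma vertex_factor_geodesic:
  assumes geo: "geodesic ((w, b) # ws)" and x: "x \<in> topspace X"
  shows "vertex_factor (gp_word ((w, b) # ws)) x
    = (if w = v then h (b, \<beta> (gp_word ws) x) else 1) * vertex_factor (gp_word ws) x"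
proof -
  let ?s = "gp_word ws" and ?b = "gp_incl V E G w b"
  have wb: "w \<in> V" "b \<in> carrier (G w)" "ws \<in> fp_words V G"
    using geodesic_words[OF geo] by auto
  have s: "?s \<in> carrier P" using wb by (simp add: gp_word_closed)
  have y: "\<beta> ?s x \<in> topspace X" using s x by (simp add: \<beta>_closed)
  have red: "T.reduced (tree_action ?s [])" using s by (simp add: reduced_tree_action)
  have bP: "?b \<in> carrier P" using wb by (simp add: gp_incl_closed)
  have eq: "vertex_factor (gp_word ((w, b) # ws)) x
      = T.coeff (\<alpha> w b (\<beta> ?s x)) (vertex_act w b (tree_action ?s []))"
    using wb s x by (simp add: vertex_factor_def tree_action_step \<beta>_mult \<beta>_incl gp_incl_closed)
  show ?thesis
  proof (cases "w = v")
    case False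
    have "T.coeff (\<beta> ?b (\<beta> ?s x)) (T.relabel ((<#\<^bsub>P\<^esub>) ?b) (tree_action ?s []))
        = T.coeff (\<beta> ?s x) (tree_action ?s [])"
      by (rule T.coeff_relabel)
        (use bP y red in \<open>auto simp: coset_inj coset_mult coset_act_shift coset_kernel_shift \<beta>_closed\<close>)
    then show ?thesis using False wb eq by (simp add: vertex_act_def \<beta>_incl vertex_factor_def)
  next
    case True
    have "\<not> T.starts_with L (tree_action ?s [])"
    proof
      assume "T.starts_with L (tree_action ?s [])"
      then obtain g t where "tree_action ?s [] = (L, g) # t" by (cases "tree_action ?s []") auto
      then obtain us ws' where "ws = us @ (v, g) # ws'" "gp_word us <#\<^bsub>P\<^esub> L = L"
        using tree_action_geodesic_head[OF geodesic_ConsD[OF geo], of L g t] by blast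
      then show False
        using geodesic_not_starts_with[of b us g ws'] geo by (simp add: True)
    qed
    then have "T.coeff (coset_act L b (\<beta> ?s x)) (T.left_mult L b (tree_action ?s []))
        = coset_kernel L (coset_act L b (\<beta> ?s x)) \<one>\<^bsub>G v\<^esub> b * T.coeff (\<beta> ?s x) (tree_action ?s [])"
      using wb y by (intro T.coeff_left_mult) (auto simp: L_coset True)
    then show ?thesis
      using True wb y eq by (simp add: coset_act_L coset_kernel_L vertex_act_def vertex_factor_def)
  qed
qed

end

section \<open>Transformation groupoids of discrete groups\<close>

lemma topspace_tg: "topspace (tg_topology G X) = carrier G \<times> topspace X"
  by (simp add: tg_topology_def)

lemma continuous_map_tg:
  "continuous_map (tg_topology G X) euclidean f \<longleftrightarrow>
     (\<forall>s\<in>carrier G. continuous_map X euclidean (\<lambda>x. f (s, x)))"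
proof
  assume f: "continuous_map (tg_topology G X) euclidean f"
  show "\<forall>s\<in>carrier G. continuous_map X euclidean (\<lambda>x. f (s, x))"
  proof
    fix s assume "s \<in> carrier G"
    then have "continuous_map X (tg_topology G X) (\<lambda>x. (s, x))"
      by (auto simp: tg_topology_def intro!: continuous_map_pairedI)
    from continuous_map_compose[OF this f] show "continuous_map X euclidean (\<lambda>x. f (s, x))"
      by (simp add: comp_def)
  qed
next
  assume f: "\<forall>s\<in>carrier G. continuous_map X euclidean (\<lambda>x. f (s, x))"
  show "continuous_map (tg_topology G X) euclidean f"
    unfolding continuous_map_def
  proof (intro conjI allI impI)
    fix U :: "'c set" assume U: "openin euclidean U"
    have eq: "{p \<in> topspace (tg_topology G X). f p \<in> U}
        = (\<Union>s\<in>carrier G. {s} \<times> {x \<in> topspace X. f (s, x) \<in> U})"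
      by (auto simp: topspace_tg)
    have "openin (tg_topology G X) ({s} \<times> {x \<in> topspace X. f (s, x) \<in> U})" if "s \<in> carrier G" for s
      using f U that unfolding tg_topology_def openin_prod_Times_iff by (auto simp: continuous_map_def)
    then show "openin (tg_topology G X) {p \<in> topspace (tg_topology G X). f p \<in> U}"
      unfolding eq by (intro openin_Union) auto
  qed auto
qed

lemma tg_compactin_fst:
  assumes "compactin (tg_topology G X) K"
  shows "finite (fst ` K)" "K \<subseteq> (fst ` K) \<times> topspace X" "fst ` K \<subseteq> carrier G"
proof -
  have "compactin (discrete_topology (carrier G)) (fst ` K)"
    using image_compactin[OF assms] continuous_map_fst unfolding tg_topology_def by blast
  then show "finite (fst ` K)" "fst ` K \<subseteq> carrier G" by (auto simp: compactin_discrete_topology)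
  show "K \<subseteq> (fst ` K) \<times> topspace X"
    using compactin_subset_topspace[OF assms] by (force simp: topspace_tg)
qed

lemma tg_compactin_Times:
  assumes "compact_space X" "finite S" "S \<subseteq> carrier G"
  shows "compactin (tg_topology G X) (S \<times> topspace X)"
  using assms by (simp add: tg_topology_def compactin_Times compactin_discrete_topology compact_space_def)

text \<open>Compact sets of the groupoid project to finite sets of group elements; conversely, a finite set
  times \<open>X\<close> is compact.\<close>

lemma C0_functions_tg:
  assumes X: "compact_space X"
  shows "f \<in> C0_functions (tg_topology G X) \<longleftrightarrow> continuous_map (tg_topology G X) euclidean f \<and>
    (\<forall>\<epsilon>>0. finite {s \<in> carrier G. \<exists>x\<in>topspace X. \<epsilon> \<le> cmod (f (s, x))})"
proof -
  have "(\<exists>K. compactin (tg_topology G X) K \<and> (\<forall>p\<in>topspace (tg_topology G X) - K. cmod (f p) < \<epsilon>))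
      \<longleftrightarrow> finite {s \<in> carrier G. \<exists>x\<in>topspace X. \<epsilon> \<le> cmod (f (s, x))}" (is "?l \<longleftrightarrow> finite ?S") for \<epsilon>
  proof
    assume ?l
    then obtain K where K: "compactin (tg_topology G X) K"
      "\<And>p. p \<in> topspace (tg_topology G X) - K \<Longrightarrow> cmod (f p) < \<epsilon>" by blast
    have "?S \<subseteq> fst ` K"
    proof
      fix s assume "s \<in> ?S"
      then obtain x where x: "s \<in> carrier G" "x \<in> topspace X" "\<epsilon> \<le> cmod (f (s, x))" by blast
      then have "(s, x) \<in> K" using K(2)[of "(s, x)"] by (force simp: topspace_tg)
      then show "s \<in> fst ` K" by force
    qed
    then show "finite ?S" using tg_compactin_fst(1)[OF K(1)] finite_subset by blast
  next
    assume "finite ?S"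
    then have "compactin (tg_topology G X) (?S \<times> topspace X)"
      by (intro tg_compactin_Times X) auto
    then show ?l by (intro exI[of _ "?S \<times> topspace X"]) (force simp: topspace_tg not_less)
  qed
  then show ?thesis by (simp add: C0_functions_def)
qed

lemma uniform_limit_tg_compacts:
  assumes X: "compact_space X"
  shows "(\<forall>K. compactin (tg_topology G X) K \<longrightarrow> uniform_limit K h (\<lambda>_. l) sequentially) \<longleftrightarrow>
    (\<forall>s\<in>carrier G. uniform_limit (topspace X) (\<lambda>n x. h n (s, x)) (\<lambda>_. l) sequentially)" (is "?l \<longleftrightarrow> ?r")
proof
  assume ?l
  show ?r
  proof
    fix s assume "s \<in> carrier G"
    then have "compactin (tg_topology G X) ({s} \<times> topspace X)"
      by (intro tg_compactin_Times X) auto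
    then have "uniform_limit ({s} \<times> topspace X) h (\<lambda>_. l) sequentially" using \<open>?l\<close> by blast
    then show "uniform_limit (topspace X) (\<lambda>n x. h n (s, x)) (\<lambda>_. l) sequentially"
      by (rule uniform_limit_compose') auto
  qed
next
  assume r: ?r
  show ?l
  proof (intro allI impI)
    fix K assume "compactin (tg_topology G X) K"
    note K = tg_compactin_fst[OF this]
    show "uniform_limit K h (\<lambda>_. l) sequentially"
      unfolding uniform_limit_iff
    proof (intro allI impI)
      fix e :: real assume "e > 0"
      then have "\<forall>s\<in>fst ` K. \<forall>\<^sub>F n in sequentially. \<forall>x\<in>topspace X. dist (h n (s, x)) l < e"
        using r K(3) by (force simp: uniform_limit_iff)
      then have "\<forall>\<^sub>F n in sequentially. \<forall>s\<in>fst ` K. \<forall>x\<in>topspace X. dist (h n (s, x)) l < e"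
        by (rule eventually_ball_finite[OF K(1)])
      then show "\<forall>\<^sub>F n in sequentially. \<forall>p\<in>K. dist (h n p) l < e"
        by (rule eventually_mono) (use K(2) in fastforce)
    qed
  qed
qed

lemma haagerup_witness_iff:
  assumes "compact_space X"
  shows "haagerup_witness G X \<alpha> h \<longleftrightarrow>
    (\<forall>n. tg_positive_definite G X \<alpha> (h n) \<and>
       (\<forall>\<epsilon>>0. finite {s \<in> carrier G. \<exists>x\<in>topspace X. \<epsilon> \<le> cmod (h n (s, x))})) \<and>
    (\<forall>s\<in>carrier G. uniform_limit (topspace X) (\<lambda>n x. h n (s, x)) (\<lambda>_. 1) sequentially)"
  unfolding haagerup_witness_def C0_functions_tg[OF assms] uniform_limit_tg_compacts[OF assms]
  by (auto simp: tg_positive_definite_def)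

lemma continuous_map_complex_mult:
  "\<lbrakk>continuous_map X euclidean f; continuous_map X euclidean g\<rbrakk>
     \<Longrightarrow> continuous_map X euclidean (\<lambda>x. f x * g x :: complex)"
  by (simp add: continuous_map_atin tendsto_mult)

lemma positive_definite_norm_le_1:
  assumes G: "group G" and \<alpha>: "homeo_action G X \<alpha>" and h: "tg_positive_definite G X \<alpha> h" "tg_unital G X h"
    and g: "g \<in> carrier G" and x: "x \<in> topspace X"
  shows "cmod (h (g, x)) \<le> 1"
proof -
  interpret G: group G by fact
  let ?k = "\<lambda>s t. h (inv\<^bsub>G\<^esub> s \<otimes>\<^bsub>G\<^esub> t, \<alpha> (inv\<^bsub>G\<^esub> t) (\<alpha> g x))"
  have gx: "\<alpha> g x \<in> topspace X" using g x by (rule homeo_action_closed[OF \<alpha>])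
  have "pd_kernel (carrier G) ?k"
    using h(1) gx unfolding tg_positive_definite_kernel[OF G \<alpha>] by blast
  moreover have "?k s s = 1" if "s \<in> carrier G" for s
    using that h(2) gx homeo_action_closed[OF \<alpha>] by (simp add: tg_unital_def)
  ultimately have "cmod (?k \<one>\<^bsub>G\<^esub> g) \<le> 1"
    using g pd_kernel_norm_le_1[of "carrier G" ?k "\<one>\<^bsub>G\<^esub>" g] by blast
  then show ?thesis using g x by (simp add: homeo_action_inv[OF \<alpha>])
qed

text \<open>The product of \<open>h\<close> with the positive definite function on the group with values \<open>1\<close> at the neutral
  element and \<open>r\<close> elsewhere.\<close>

definition damped :: "('g, 'm) monoid_scheme \<Rightarrow> real \<Rightarrow> ('g \<times> 'x \<Rightarrow> complex) \<Rightarrow> 'g \<times> 'x \<Rightarrow> complex" where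
  "damped G r h = (\<lambda>(g, x). (if g = \<one>\<^bsub>G\<^esub> then 1 else of_real r) * h (g, x))"

lemma damped_unital: "tg_unital G X h \<Longrightarrow> tg_unital G X (damped G r h)"
  by (simp add: tg_unital_def damped_def)

text \<open>The damped kernel is the convex combination of the kernel and of its diagonal part.\<close>

lemma damped_positive_definite:
  assumes G: "group G" and \<alpha>: "homeo_action G X \<alpha>" and h: "tg_positive_definite G X \<alpha> h"
    and r: "0 \<le> r" "r \<le> 1"
  shows "tg_positive_definite G X \<alpha> (damped G r h)"
  unfolding tg_positive_definite_kernel[OF G \<alpha>] continuous_map_tg
proof (intro conjI ballI)
  interpret G: group G by fact
  note h' = h[unfolded tg_positive_definite_kernel[OF G \<alpha>] continuous_map_tg]
  show "continuous_map X euclidean (\<lambda>x. damped G r h (s, x))" if "s \<in> carrier G" for s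
    using h' that by (auto simp: damped_def intro!: continuous_map_complex_mult)
  fix x assume x: "x \<in> topspace X"
  let ?k = "\<lambda>s t. h (inv\<^bsub>G\<^esub> s \<otimes>\<^bsub>G\<^esub> t, \<alpha> (inv\<^bsub>G\<^esub> t) x)"
  have k: "pd_kernel (carrier G) ?k" using h' x by blast
  have scale: "pd_kernel S (\<lambda>s t. of_real c * k s t)" if "pd_kernel S k" "0 \<le> c"
    for S :: "'a set" and c and k :: "'a \<Rightarrow> 'a \<Rightarrow> complex"
  proof -
    have c: "of_real (sqrt c) * of_real (sqrt c) = (of_real c :: complex)"
      using that(2) by (simp flip: of_real_mult)
    have eq: "cnj (of_real (sqrt c)) * z * of_real (sqrt c) = of_real c * z" for z
      unfolding c[symmetric] by simp
    show ?thesis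
      using pd_kernel_scale[OF that(1), of "\<lambda>_. of_real (sqrt c)"] by (simp only: eq)
  qed
  have diag: "pd_kernel (carrier G) (\<lambda>s t. if s = t then ?k s t else 0)"
    using pd_kernel_diagonal_blocks[of "\<lambda>s. s" "carrier G" ?k]
      pd_kernel_pullback[OF k, of "{s \<in> carrier G. s = b}" "\<lambda>s. s" for b] by auto
  have "pd_kernel (carrier G) (\<lambda>s t. of_real r * ?k s t + of_real (1 - r) * (if s = t then ?k s t else 0))"
    using r by (intro pd_kernel_add scale k diag) auto
  moreover have "inv\<^bsub>G\<^esub> s \<otimes>\<^bsub>G\<^esub> t = \<one>\<^bsub>G\<^esub> \<longleftrightarrow> s = t" if "s \<in> carrier G" "t \<in> carrier G" for s t
    using that G.inv_solve_left'[of "\<one>\<^bsub>G\<^esub>" s t] by auto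
  ultimately show "pd_kernel (carrier G) (\<lambda>s t. damped G r h (inv\<^bsub>G\<^esub> s \<otimes>\<^bsub>G\<^esub> t, \<alpha> (inv\<^bsub>G\<^esub> t) x))"
    by (elim iffD1[OF pd_kernel_cong, rotated]) (auto simp: damped_def algebra_simps)
qed

section \<open>Graph products of positive definite functions\<close>

locale gp_functions = gp_action +
  fixes h :: "'a \<Rightarrow> 'b \<times> 'd \<Rightarrow> complex"
  assumes h_pd: "\<And>v. v \<in> V \<Longrightarrow> tg_positive_definite (G v) X (\<alpha> v) (h v)"
    and h_unital: "\<And>v. v \<in> V \<Longrightarrow> tg_unital (G v) X (h v)"
    and h_invariant: "\<And>v w b g x. \<lbrakk>(v, w) \<in> E; b \<in> carrier (G w); g \<in> carrier (G v); x \<in> topspace X\<rbrakk>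
          \<Longrightarrow> h v (g, \<alpha> w b x) = h v (g, x)"

context gp_action
begin

fun word_value :: "('v \<Rightarrow> 'g \<times> 'x \<Rightarrow> complex) \<Rightarrow> ('v \<times> 'g) list \<Rightarrow> 'x \<Rightarrow> complex" where
  "word_value h [] x = 1"
| "word_value h ((v, g) # ws) x = h v (g, \<beta> (gp_word ws) x) * word_value h ws x"

definition geodesic_word :: "('v \<times> 'g) list set set \<Rightarrow> ('v \<times> 'g) list" where
  "geodesic_word s = (SOME ws. geodesic ws \<and> gp_word ws = s)"

text \<open>The value does not depend on the choice of the shortest word: by \<open>word_value_eq_prod\<close> it is a
  product of vertex factors, which involve no choice.\<close>

definition product_function :: "('v \<Rightarrow> 'g \<times> 'x \<Rightarrow> complex) \<Rightarrow> ('v \<times> 'g) list set set \<times> 'x \<Rightarrow> complex" where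
  "product_function h = (\<lambda>(s, x). word_value h (geodesic_word s) x)"

lemma geodesic_word:
  assumes "s \<in> carrier P"
  shows "geodesic (geodesic_word s)" "gp_word (geodesic_word s) = s"
proof -
  have "\<exists>ws. geodesic ws \<and> gp_word ws = s" using geodesic_exists[OF assms] by blast
  from someI_ex[OF this] show "geodesic (geodesic_word s)" "gp_word (geodesic_word s) = s"
    by (auto simp: geodesic_word_def)
qed

lemma word_value_uniform_limit:
  assumes "ws \<in> fp_words V G"
    and "\<And>v g. (v, g) \<in> set ws
       \<Longrightarrow> uniform_limit (topspace X) (\<lambda>n x. h n v (g, x)) (\<lambda>_. 1) sequentially"
  shows "uniform_limit (topspace X) (\<lambda>n x. word_value (h n) ws x) (\<lambda>_. 1) sequentially"
  using assms
proof (induction ws rule: gp_word.induct)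
  case 1
  show ?case by (simp add: uniform_limit_const)
next
  case (2 v g ws)
  have "uniform_limit (topspace X) (\<lambda>n x. h n v (g, \<beta> (gp_word ws) x)) (\<lambda>_. 1) sequentially"
    by (rule uniform_limit_compose'[where A = "topspace X" and f = "\<lambda>n x. h n v (g, x)"
          and g = "\<lambda>_. 1" and h = "\<beta> (gp_word ws)"])
      (use 2 in \<open>auto simp: \<beta>_closed gp_word_closed\<close>)
  then have "uniform_limit (topspace X)
      (\<lambda>n x. h n v (g, \<beta> (gp_word ws) x) * word_value (h n) ws x) (\<lambda>_. 1 * 1) sequentially"
    using 2 by (intro uniform_lim_mult) (auto simp: image_constant_conv)
  then show ?case by simp
qed

end

context gp_functions
begin

lemma gp_vertex: "v \<in> V \<Longrightarrow> gp_vertex V G E X \<alpha> v (h v)"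
  by unfold_locales (use h_pd h_unital h_invariant in auto)

lemma h_norm_le_1: "\<lbrakk>v \<in> V; g \<in> carrier (G v); x \<in> topspace X\<rbrakk> \<Longrightarrow> cmod (h v (g, x)) \<le> 1"
  using positive_definite_norm_le_1[OF grp act h_pd h_unital] by blast

lemma word_value_eq_prod:
  assumes "finite S" "S \<subseteq> V" "x \<in> topspace X"
  shows "geodesic ws \<Longrightarrow> fst ` set ws \<subseteq> S \<Longrightarrow> word_value h ws x
    = (\<Prod>v\<in>S. gp_vertex.vertex_factor V G E X \<alpha> v (h v) (gp_word ws) x)"
proof (induction ws)
  case Nil
  show ?case
    using assms gp_vertex.vertex_factor_one[OF gp_vertex] by (simp add: subset_iff)
next
  case (Cons p ws)
  obtain w b where p: "p = (w, b)" by (cases p)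
  let ?f = "\<lambda>v. gp_vertex.vertex_factor V G E X \<alpha> v (h v)"
  have "(\<Prod>v\<in>S. ?f v (gp_word (p # ws)) x)
      = (\<Prod>v\<in>S. (if w = v then h v (b, \<beta> (gp_word ws) x) else 1) * ?f v (gp_word ws) x)"
    unfolding p
    by (rule prod.cong[OF HOL.refl])
      (use gp_vertex.vertex_factor_geodesic[OF gp_vertex] Cons.prems assms p in blast)
  also have "\<dots> = (\<Prod>v\<in>S. if w = v then h v (b, \<beta> (gp_word ws) x) else 1) * (\<Prod>v\<in>S. ?f v (gp_word ws) x)"
    by (rule prod.distrib)
  also have "(\<Prod>v\<in>S. if w = v then h v (b, \<beta> (gp_word ws) x) else 1) = h w (b, \<beta> (gp_word ws) x)"
    using assms Cons.prems by (simp add: p prod.delta')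
  also have "(\<Prod>v\<in>S. ?f v (gp_word ws) x) = word_value h ws x"
    using Cons.IH geodesic_ConsD[OF Cons.prems(1)] Cons.prems(2) by simp
  finally show ?case by (simp add: p)
qed

text \<open>For finitely many group elements \<open>s i\<close> only the finite set \<open>S\<close> of vertices in the chosen words for
  the quotients of the \<open>s i\<close> matters, and the Schur product theorem applies to the vertex factors of \<open>S\<close>.\<close>

lemma product_function_pd:
  assumes x: "x \<in> topspace X"
  shows "pd_kernel (carrier P)
    (\<lambda>s t. product_function h (inv\<^bsub>P\<^esub> s \<otimes>\<^bsub>P\<^esub> t, \<beta> (inv\<^bsub>P\<^esub> t) x))"
  unfolding pd_kernel_def
proof (intro allI impI)
  interpret P: group P by (rule group_gp)
  fix n and s :: "nat \<Rightarrow> ('a \<times> 'b) list set set" assume s: "\<forall>i<n. s i \<in> carrier P"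
  define ws where "ws i j = geodesic_word (inv\<^bsub>P\<^esub> s i \<otimes>\<^bsub>P\<^esub> s j)" for i j
  define S where "S = (\<Union>i<n. \<Union>j<n. fst ` set (ws i j))"
  have ws: "geodesic (ws i j)" "gp_word (ws i j) = inv\<^bsub>P\<^esub> s i \<otimes>\<^bsub>P\<^esub> s j" if "i < n" "j < n" for i j
    using that s geodesic_word by (simp_all add: ws_def)
  have S: "finite S" "S \<subseteq> V"
  proof -
    show "finite S" by (simp add: S_def)
    have "fst ` set (ws i j) \<subseteq> V" if "i < n" "j < n" for i j
      using geodesic_words[OF ws(1)[OF that]] by (auto simp: fp_words_def)
    then show "S \<subseteq> V" by (auto simp: S_def)
  qed
  let ?f = "\<lambda>v. gp_vertex.vertex_factor V G E X \<alpha> v (h v)"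
  have "pd_kernel (carrier P) (\<lambda>s t. \<Prod>v\<in>S. ?f v (inv\<^bsub>P\<^esub> s \<otimes>\<^bsub>P\<^esub> t) (\<beta> (inv\<^bsub>P\<^esub> t) x))"
    using S x by (intro pd_kernel_prod gp_vertex.vertex_factor_pd[OF gp_vertex]) auto
  then have "psd_matrix n (\<lambda>i j. \<Prod>v\<in>S. ?f v (inv\<^bsub>P\<^esub> s i \<otimes>\<^bsub>P\<^esub> s j) (\<beta> (inv\<^bsub>P\<^esub> s j) x))"
    by (rule pd_kernelD) (use s in blast)
  then show "psd_matrix n (\<lambda>i j. product_function h (inv\<^bsub>P\<^esub> s i \<otimes>\<^bsub>P\<^esub> s j, \<beta> (inv\<^bsub>P\<^esub> s j) x))"
  proof (rule iffD1[OF psd_matrix_cong, rotated])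
    fix i j assume ij: "i < n" "j < n"
    have "\<beta> (inv\<^bsub>P\<^esub> s j) x \<in> topspace X" using s ij x by (simp add: \<beta>_closed)
    moreover have "fst ` set (ws i j) \<subseteq> S" using ij by (auto simp: S_def)
    ultimately show "(\<Prod>v\<in>S. ?f v (inv\<^bsub>P\<^esub> s i \<otimes>\<^bsub>P\<^esub> s j) (\<beta> (inv\<^bsub>P\<^esub> s j) x))
        = product_function h (inv\<^bsub>P\<^esub> s i \<otimes>\<^bsub>P\<^esub> s j, \<beta> (inv\<^bsub>P\<^esub> s j) x)"
      using word_value_eq_prod[OF S, of "\<beta> (inv\<^bsub>P\<^esub> s j) x" "ws i j"] ws[OF ij]
      by (simp add: product_function_def flip: ws_def)
  qed
qed

lemma word_value_continuous:
  "ws \<in> fp_words V G \<Longrightarrow> continuous_map X euclidean (word_value h ws)"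
proof (induction ws rule: gp_word.induct)
  case 1
  then show ?case by simp
next
  case (2 v g ws)
  have "continuous_map X euclidean (\<lambda>x. h v (g, x))"
    using 2 h_pd[of v] unfolding tg_positive_definite_kernel[OF grp act] continuous_map_tg
    by (simp add: tg_positive_definite_def continuous_map_tg)
  then have "continuous_map X euclidean ((\<lambda>x. h v (g, x)) \<circ> \<beta> (gp_word ws))"
    using 2 by (intro continuous_map_compose[OF homeo_action_continuous[OF homeo_\<beta>]])
      (simp_all add: gp_word_closed)
  then show ?case
    using 2 by (simp add: comp_def continuous_map_complex_mult)
qed

lemma product_function_positive_definite: "tg_positive_definite P X \<beta> (product_function h)"
  unfolding tg_positive_definite_kernel[OF group_gp homeo_\<beta>] continuous_map_tg
  using product_function_pd word_value_continuous[OF geodesic_words[OF geodesic_word(1)]]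
  by (simp add: product_function_def)

lemma word_value_norm_le_1:
  "ws \<in> fp_words V G \<Longrightarrow> x \<in> topspace X \<Longrightarrow> cmod (word_value h ws x) \<le> 1"
  by (induction ws rule: gp_word.induct)
    (auto simp: norm_mult h_norm_le_1 \<beta>_closed gp_word_closed intro!: mult_le_one)

lemma word_value_norm_le_power:
  assumes r: "0 \<le> r"
    and small: "\<And>v g x. \<lbrakk>v \<in> V; g \<in> carrier (G v); g \<noteq> \<one>\<^bsub>G v\<^esub>; x \<in> topspace X\<rbrakk> \<Longrightarrow> cmod (h v (g, x)) \<le> r"
    and x: "x \<in> topspace X"
  shows "ws \<in> fp_words V G \<Longrightarrow> (\<And>v g. (v, g) \<in> set ws \<Longrightarrow> g \<noteq> \<one>\<^bsub>G v\<^esub>)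
    \<Longrightarrow> cmod (word_value h ws x) \<le> r ^ length ws"
proof (induction ws rule: gp_word.induct)
  case (2 v g ws)
  have "cmod (h v (g, \<beta> (gp_word ws) x)) \<le> r"
    using 2 x by (intro small) (auto simp: \<beta>_closed gp_word_closed)
  then show ?case using 2 r by (simp add: norm_mult mult_mono)
qed simp

lemma word_value_letters_large:
  assumes x: "x \<in> topspace X"
  shows "ws \<in> fp_words V G \<Longrightarrow> \<epsilon> \<le> cmod (word_value h ws x) \<Longrightarrow> (v, g) \<in> set ws
    \<Longrightarrow> \<exists>y\<in>topspace X. \<epsilon> \<le> cmod (h v (g, y))"
proof (induction ws rule: gp_word.induct)
  case (2 w b ws)
  let ?y = "\<beta> (gp_word ws) x"
  have y: "?y \<in> topspace X" using 2 x by (simp add: \<beta>_closed gp_word_closed)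
  have 1: "cmod (h w (b, ?y)) \<le> 1" "cmod (word_value h ws x) \<le> 1"
    using 2 x y by (auto intro: h_norm_le_1 word_value_norm_le_1)
  have "\<epsilon> \<le> cmod (h w (b, ?y)) * cmod (word_value h ws x)" using 2 by (simp add: norm_mult)
  then have "\<epsilon> \<le> cmod (h w (b, ?y))" "\<epsilon> \<le> cmod (word_value h ws x)"
    using 1 mult_left_le[of "cmod (word_value h ws x)" "cmod (h w (b, ?y))"]
      mult_left_le_one_le[of "cmod (word_value h ws x)" "cmod (h w (b, ?y))"] by auto
  then show ?case using 2 y by auto
qed simp

text \<open>A value of modulus at least \<open>\<epsilon>\<close> requires a word of bounded length, since each letter contributes a
  factor at most \<open>r\<close>, and all its letters in a finite set, since every single factor has modulus at
  least \<open>\<epsilon>\<close>.\<close>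

lemma product_function_vanishes_at_infinity:
  assumes r: "0 \<le> r" "r < 1"
    and small: "\<And>v g x. \<lbrakk>v \<in> V; g \<in> carrier (G v); g \<noteq> \<one>\<^bsub>G v\<^esub>; x \<in> topspace X\<rbrakk> \<Longrightarrow> cmod (h v (g, x)) \<le> r"
    and S: "finite S"
      "\<And>v g x. \<lbrakk>v \<in> V - S; g \<in> carrier (G v); g \<noteq> \<one>\<^bsub>G v\<^esub>; x \<in> topspace X\<rbrakk> \<Longrightarrow> h v (g, x) = 0"
    and fin: "\<And>v \<epsilon>. v \<in> V \<Longrightarrow> \<epsilon> > 0 \<Longrightarrow> finite {g \<in> carrier (G v). \<exists>x\<in>topspace X. \<epsilon> \<le> cmod (h v (g, x))}"
    and \<epsilon>: "\<epsilon> > 0"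
  shows "finite {s \<in> carrier P. \<exists>x\<in>topspace X. \<epsilon> \<le> cmod (product_function h (s, x))}"
proof -
  obtain m where m: "r ^ m < \<epsilon>" using real_arch_pow_inv[OF \<epsilon> r(2)] by blast
  define B where "B = (SIGMA v : S \<inter> V. {g \<in> carrier (G v). \<exists>x\<in>topspace X. \<epsilon> \<le> cmod (h v (g, x))})"
  have "finite B" unfolding B_def using S(1) fin[OF _ \<epsilon>] by (intro finite_SigmaI) auto
  then have "finite (gp_word ` {ws. set ws \<subseteq> B \<and> length ws \<le> m})"
    by (intro finite_imageI finite_lists_length_le)
  moreover have "{s \<in> carrier P. \<exists>x\<in>topspace X. \<epsilon> \<le> cmod (product_function h (s, x))}
      \<subseteq> gp_word ` {ws. set ws \<subseteq> B \<and> length ws \<le> m}"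
  proof
    fix s assume "s \<in> {s \<in> carrier P. \<exists>x\<in>topspace X. \<epsilon> \<le> cmod (product_function h (s, x))}"
    then obtain x where s: "s \<in> carrier P" and x: "x \<in> topspace X"
      and large: "\<epsilon> \<le> cmod (word_value h (geodesic_word s) x)"
      by (auto simp: product_function_def)
    define ws where "ws = geodesic_word s"
    have ws: "geodesic ws" "gp_word ws = s" "ws \<in> fp_words V G"
      using geodesic_word[OF s] geodesic_words by (auto simp: ws_def)
    note ne = geodesic_letters_neq_one[OF ws(1)]
    have "length ws \<le> m"
    proof (rule ccontr)
      assume "\<not> length ws \<le> m"
      then have "r ^ length ws \<le> r ^ m" using r by (intro power_decreasing) auto
      then show False
        using word_value_norm_le_power[OF r(1) small x ws(3) ne] large m by (simp add: ws_def)
    qed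
    moreover have "(v, g) \<in> B" if vg: "(v, g) \<in> set ws" for v g
    proof -
      have V: "v \<in> V" "g \<in> carrier (G v)" using ws(3) vg by (auto simp: fp_words_def)
      obtain y where y: "y \<in> topspace X" "\<epsilon> \<le> cmod (h v (g, y))"
        using word_value_letters_large[OF x ws(3) _ vg] large by (auto simp: ws_def)
      then have "v \<in> S" using S(2)[of v g y] V ne[OF vg] \<epsilon> by force
      then show ?thesis using V y by (auto simp: B_def)
    qed
    ultimately show "s \<in> gp_word ` {ws. set ws \<subseteq> B \<and> length ws \<le> m}" using ws(2) by force
  qed
  ultimately show ?thesis by (rule finite_subset[rotated])
qed

end

text \<open>Choosing a nontrivial letter for each vertex embeds these vertices into the graph product.\<close>

lemma (in group_graph) countable_nontrivial_vertices:
  assumes "countable (carrier P)"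
  shows "countable {v \<in> V. carrier (G v) \<noteq> {\<one>\<^bsub>G v\<^esub>}}" (is "countable ?U")
proof -
  have "\<exists>g. g \<in> carrier (G v) \<and> g \<noteq> \<one>\<^bsub>G v\<^esub>" if "v \<in> ?U" for v
    using that monoid.one_closed[OF group.is_monoid[OF grp]] by blast
  then have "\<forall>v\<in>?U. \<exists>g. g \<in> carrier (G v) \<and> g \<noteq> \<one>\<^bsub>G v\<^esub>" by blast
  from bchoice[OF this]
  obtain g where g: "\<And>v. v \<in> ?U \<Longrightarrow> g v \<in> carrier (G v) \<and> g v \<noteq> \<one>\<^bsub>G v\<^esub>" by blast
  have inj: "inj_on (\<lambda>v. gp_incl V E G v (g v)) ?U"
    by (rule inj_onI) (use g gp_incl_letter_inj in blast)
  have im: "(\<lambda>v. gp_incl V E G v (g v)) ` ?U \<subseteq> carrier P"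
    using g by (auto intro: gp_incl_closed)
  show ?thesis by (rule countable_image_inj_on[OF countable_subset[OF im assms] inj])
qed

theorem corollary5p5:
  fixes V :: "'v set" and E :: "'v rel"
    and G :: "'v \<Rightarrow> ('g, 'm) monoid_scheme"
    and X :: "'x topology"
    and \<alpha> :: "'v \<Rightarrow> 'g \<Rightarrow> 'x \<Rightarrow> 'x"
    and h :: "'v \<Rightarrow> nat \<Rightarrow> 'g \<times> 'x \<Rightarrow> complex"
  assumes "simplicial_graph V E"
    and "compact_space X" and "Hausdorff_space X"
    and "\<And>v. v \<in> V \<Longrightarrow> group (G v)"
    and "\<And>v. v \<in> V \<Longrightarrow> countable (carrier (G v))"
    and "countable (carrier (graph_product V E G))"
    and "\<And>v. v \<in> V \<Longrightarrow> homeo_action (G v) X (\<alpha> v)"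
    and "\<And>v. v \<in> V \<Longrightarrow> tg_haagerup (G v) X (\<alpha> v)"
    and "commuting_actions E G X \<alpha>"
    and "\<And>v. v \<in> V \<Longrightarrow> haagerup_witness (G v) X (\<alpha> v) (h v)"
    and "\<And>v n. v \<in> V \<Longrightarrow> tg_unital (G v) X (h v n)"
    and "\<And>n. commuting_multipliers E G X \<alpha> (\<lambda>v. h v n)"
  shows "tg_haagerup (graph_product V E G) X (graph_product_action V E G X \<alpha>)"
proof -
  note X = \<open>compact_space X\<close>
  interpret gp_action V G E X \<alpha>
    by (intro gp_action.intro gp_action_axioms.intro group_graph.intro group_graph_axioms.intro
        group_family.intro) (use assms in auto)
  note wit = assms(10)[unfolded haagerup_witness_iff[OF X]]
  define U where "U = {v \<in> V. carrier (G v) \<noteq> {\<one>\<^bsub>G v\<^esub>}}"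
  have U: "countable U"
    unfolding U_def by (rule countable_nontrivial_vertices) (rule assms)
  define q :: "nat \<Rightarrow> real" where "q n = real n / real (Suc n)" for n
  have q: "0 \<le> q n" "q n < 1" for n by (auto simp: q_def divide_le_eq)
  \<comment> \<open>At stage \<open>n\<close> only the first \<open>n + 1\<close> vertices with nontrivial group survive, damped by \<open>q n\<close>.\<close>
  define \<rho> :: "nat \<Rightarrow> 'v \<Rightarrow> real" where
    "\<rho> n v = (if to_nat_on U v \<le> n then q n else 0)" for n v
  have \<rho>: "0 \<le> \<rho> n v" "\<rho> n v \<le> q n" "\<rho> n v \<le> 1" for n v
    using q[of n] by (auto simp: \<rho>_def)
  define k where "k n v = damped (G v) (\<rho> n v) (h v n)" for n v
  have inv: "h v n (g, \<alpha> w b x) = h v n (g, x)"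
    if vw: "(v, w) \<in> E" "b \<in> carrier (G w)" "g \<in> carrier (G v)" "x \<in> topspace X" for v w b g x n
  proof -
    interpret Gw: group "G w" using edge_in[OF vw(1)] by (intro grp) simp
    \<comment> \<open>The induced action involves an inverse, hence the hypothesis is used for \<open>inv b\<close>.\<close>
    have "induced_action (G w) (\<alpha> w) (inv\<^bsub>G w\<^esub> b) (multiplier (h v n) g) x = multiplier (h v n) g x"
      using assms(12)[of n] vw unfolding commuting_multipliers_def by fastforce
    then show ?thesis using vw by (simp add: induced_action_def multiplier_def)
  qed
  have gpf: "gp_functions V G E X \<alpha> (k n)" for n
  proof unfold_locales
    fix v assume v: "v \<in> V"
    show "tg_positive_definite (G v) X (\<alpha> v) (k n v)"
      unfolding k_def using wit[OF v] \<rho> by (intro damped_positive_definite grp act v) auto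
    show "tg_unital (G v) X (k n v)"
      unfolding k_def by (intro damped_unital assms(11) v)
  next
    fix v w b g x assume "(v, w) \<in> E" "b \<in> carrier (G w)" "g \<in> carrier (G v)" "x \<in> topspace X"
    then show "k n v (g, \<alpha> w b x) = k n v (g, x)" by (simp add: k_def damped_def inv)
  qed
  have le: "cmod (k n v (g, x)) \<le> (if g = \<one>\<^bsub>G v\<^esub> then 1 else \<rho> n v) * cmod (h v n (g, x))" for n v g x
    using \<rho>(1)[of n v] by (simp add: k_def damped_def norm_mult)
  have h1: "cmod (h v n (g, x)) \<le> 1" if "v \<in> V" "g \<in> carrier (G v)" "x \<in> topspace X" for n v g x
    using that wit[OF that(1)] by (intro positive_definite_norm_le_1[OF grp act _ assms(11)]) auto
  have "finite {s \<in> carrier P. \<exists>x\<in>topspace X. \<epsilon> \<le> cmod (product_function (k n) (s, x))}"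
    if \<epsilon>: "\<epsilon> > 0" for n \<epsilon>
  proof -
    interpret gp_functions V G E X \<alpha> "k n" by (rule gpf)
    show ?thesis
    proof (rule product_function_vanishes_at_infinity[where r = "q n" and S = "{v \<in> U. to_nat_on U v \<le> n}"])
      show "0 \<le> q n" "q n < 1" by (rule q)+
      show "\<epsilon> > 0" by (rule \<epsilon>)
      show "finite {v \<in> U. to_nat_on U v \<le> n}"
        using finite_vimage_IntI[of "{..n}" "to_nat_on U" U] inj_on_to_nat_on[OF U]
        by (simp add: vimage_def Int_def conj_commute)
    next
      fix v g x assume v: "v \<in> V" "g \<in> carrier (G v)" "g \<noteq> \<one>\<^bsub>G v\<^esub>" "x \<in> topspace X"
      have "cmod (k n v (g, x)) \<le> \<rho> n v * 1"
        using le[of n v g x] mult_left_mono[OF h1[OF v(1,2,4), of n] \<rho>(1)[of n v]] v(3) by simp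
      then show "cmod (k n v (g, x)) \<le> q n" using \<rho>(2)[of n v] by simp
    next
      fix v g x assume v: "v \<in> V - {v \<in> U. to_nat_on U v \<le> n}" "g \<in> carrier (G v)" "g \<noteq> \<one>\<^bsub>G v\<^esub>"
      then have "v \<in> U" by (auto simp: U_def)
      then have "\<rho> n v = 0" using v by (simp add: \<rho>_def)
      then show "k n v (g, x) = 0" using v by (simp add: k_def damped_def)
    next
      fix v and \<epsilon> :: real assume v: "v \<in> V" and \<epsilon>: "\<epsilon> > 0"
      have "cmod (k n v (g, x)) \<le> cmod (h v n (g, x))" for g x
        using le[of n v g x] mult_right_mono[OF \<rho>(3)[of n v] norm_ge_zero[of "h v n (g, x)"]]
        by (auto split: if_splits)
      then have "{g \<in> carrier (G v). \<exists>x\<in>topspace X. \<epsilon> \<le> cmod (k n v (g, x))}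
          \<subseteq> {g \<in> carrier (G v). \<exists>x\<in>topspace X. \<epsilon> \<le> cmod (h v n (g, x))}"
        using order_trans by blast
      then show "finite {g \<in> carrier (G v). \<exists>x\<in>topspace X. \<epsilon> \<le> cmod (k n v (g, x))}"
        using wit[OF v] \<epsilon> finite_subset by blast
    qed
  qed
  moreover have "tg_positive_definite P X \<beta> (product_function (k n))" for n
    by (rule gp_functions.product_function_positive_definite[OF gpf])
  moreover have "uniform_limit (topspace X) (\<lambda>n x. product_function (k n) (s, x)) (\<lambda>_. 1) sequentially"
    if s: "s \<in> carrier P" for s
  proof -
    define ws where "ws = geodesic_word s"
    have ws: "ws \<in> fp_words V G" using geodesic_word(1)[OF s] geodesic_words by (simp add: ws_def)
    have "uniform_limit (topspace X) (\<lambda>n x. k n v (g, x)) (\<lambda>_. 1) sequentially"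
      if "(v, g) \<in> set ws" for v g
    proof -
      have v: "v \<in> V" "g \<in> carrier (G v)" using ws that by (auto simp: fp_words_def)
      have "q \<longlonglongrightarrow> 1"
        unfolding q_def[abs_def] by (rule LIMSEQ_n_over_Suc_n)
      then have "(\<lambda>n. \<rho> n v) \<longlonglongrightarrow> 1"
        by (rule Lim_transform_eventually)
          (auto simp: \<rho>_def intro!: eventually_mono[OF eventually_ge_at_top[of "to_nat_on U v"]])
      then have "(\<lambda>n. complex_of_real (if g = \<one>\<^bsub>G v\<^esub> then 1 else \<rho> n v)) \<longlonglongrightarrow> of_real 1"
        by (intro tendsto_of_real) (cases "g = \<one>\<^bsub>G v\<^esub>"; simp)
      then have "uniform_limit (topspace X)
          (\<lambda>n x. complex_of_real (if g = \<one>\<^bsub>G v\<^esub> then 1 else \<rho> n v)) (\<lambda>_. of_real 1) sequentially"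
        by (auto simp: uniform_limit_iff tendsto_iff elim!: eventually_mono)
      then have "uniform_limit (topspace X)
          (\<lambda>n x. complex_of_real (if g = \<one>\<^bsub>G v\<^esub> then 1 else \<rho> n v) * h v n (g, x))
          (\<lambda>_. of_real 1 * 1) sequentially"
        using wit[OF v(1)] v(2) by (intro uniform_lim_mult) (auto simp: image_constant_conv)
      moreover have "complex_of_real (if g = \<one>\<^bsub>G v\<^esub> then 1 else \<rho> n v) * h v n (g, x) = k n v (g, x)" for n x
        by (simp add: k_def damped_def)
      ultimately show ?thesis by simp
    qed
    from word_value_uniform_limit[OF ws this] show ?thesis
      by (simp add: product_function_def ws_def)
  qed
  ultimately have "haagerup_witness P X \<beta> (\<lambda>n. product_function (k n))"
    unfolding haagerup_witness_iff[OF X] by blast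
  then show ?thesis by (auto simp: tg_haagerup_def)
qed

end
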